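(* For every augmented directed complex $K$ admitting a unitary loop-free basis, the globular set $\mu K$ of coherent chains of $K$, equipped with the compositions $a*_k a':=(a-c+a')_+$ (for $n$-cells $a,a'$ and $k<n$ with $d_k^-(a)=d_k^+(a')=:c$) and with units given by regarding a chain of degree $\le n$ as a cell of dimension $m>n$, is an $\omega$-category, and as an $\omega$-category it is isomorphic to $\nu K$. Moreover, the functor $\mu:\mathbf{CDA}_B\to\mathbf{Glob}$ lifts to a functor $\mu:\mathbf{CDA}_B\to\omega\text{-}\mathbf{cat}$, and this functor is isomorphic to the restriction of $\nu$ to $\mathbf{CDA}_B$.
   Context: **Augmented directed complexes.** An augmented directed complex $K$ is a chain complex of abelian groups $K_0\xleftarrow{\partial_0}K_1\xleftarrow{\partial_1}K_2\leftarrow\cdots$ with an augmentation $e:K_0\to\mathbb Z$ ($e\partial_0=0$) and submonoids $K_n^*\subset K_n$; morphisms are augmentation-preserving chain maps $f$ with $f(K_n^* )\subset L_n^*$. A basis of $K$ is a graded set $B=(B_n)$ such that $B_n$ is a basis of the monoid $K_n^*$ and of the group $K_n$. For $x=\sum_b\lambda_bb$: $(x)_+=\sum_{\lambda_b>0}\lambda_bb$, $(x)_-=\sum_{\lambda_b<0}-\lambda_bb$, and $\partial_n^\pm(x)=(\partial_nx)_\pm$; $x\wedge y$ is the coefficientwise minimum. For $a\in K_n^*$, $\alpha\in\{-,+\}$: $\langle a\rangle_n^\alpha=a$ and $\langle a\rangle_k^\alpha=\partial_k^\alpha\langle a\rangle_{k+1}^\alpha$ for $k<n$. The basis is unitary if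 $e(\langle b\rangle_0^-)=e(\langle b\rangle_0^+)=1$ for all $b\in B$. Let $\odot_n$ be the smallest reflexive transitive relation on $B$ with $a\odot_nb$ whenever $a,b$ have degree $\ge n$ and $\langle a\rangle_n^-\wedge\langle b\rangle_n^+\ne0$; the basis is loop-free if every $\odot_n$ is a partial order. $\mathbf{CDA}_B$ is the full subcategory of augmented directed complexes admitting a unitary loop-free basis (the basis is then unique). $\mathbf{Glob}$ is the category of globular sets, $\omega\text{-}\mathbf{cat}$ that of strict $\omega$-categories, where $d*_kc$ is defined when $d_k^+c=d_k^-d$. **The functor $\nu$** (Steiner). The $n$-cells of $\nu K$ are families $x=(x_k^\alpha)_{0\le k\le n,\alpha\in\{-,+\}}$ with $x_k^\alpha\in K_k^*$, $x_n^-=x_n^+$, $\partial_{k-1}(x_k^\alpha)=x_{k-1}^+-x_{k-1}^-$ for $0<k\le n$, $e(x_0^\pm)=1$. $d_k^\alpha x$ keeps the entries of index $<k$ and has both entries of index $k$ equal to $x_k^\alpha$; units add zero entries; if $d_k^-x=d_k^+y=z$ then $x*_ky=x-z+y$. On morphisms $\nu f$ applies $f$ entrywise. **Chains and $\mu K$.** A chain is a formal finite sum $a=\sum_{b\in B}\lambda_bb$ with $\lambda_b\in\mathbb N$ (elements of different degrees allowed); $|a|$ is the maximal degree of elements of its support ($|0|=-1$). $(a)_k$ is the part of $a$ of degree exactly $k$, and $r_k(a)$ the part of degree $\le k$. Set $d_n^\alpha(a)=a$ if $|a|\le n$ and $d_n^\alpha(a)=\partial_n^\alpha((d_{n+1}^\alpha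 a)_{n+1})+r_n(d_{n+1}^\alpha a)$ otherwise. One has $e(d_0^+a)=e(d_0^-a)$; $a$ is coherent if this equals $1$. $\mu K$ is the globular set whose $n$-cells are the coherent chains of degree $\le n$, with sources and targets $d_k^\alpha$. There are mutually inverse maps of globular sets $\phi:\nu K\to\mu K$, $\phi(x)=x_n^++\sum_{k<n}(x_k^+-\partial_k^+(x_{k+1}^+))$ for $x$ of dimension $n$, and $\psi:\mu K\to\nu K$, $\psi(a)_k^\alpha=(d_k^\alpha a)_k$. On morphisms, $\mu(f)=\phi\circ\nu(f)\circ\psi$. *)

theory Defs
  imports "HOL-Algebra.FiniteProduct" "HOL-Algebra.Elementary_Groups" "HOL-Library.Poly_Mapping"
    "HOL-Library.FuncSet"
begin

section \<open>Categories and functors\<close>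

text \<open>Composition takes the three objects as arguments because morphisms are bare (extensional)
  functions, which do not record their domain.\<close>

record ('o, 'm) category =
  Ob :: "'o set"
  Hom :: "'o \<Rightarrow> 'o \<Rightarrow> 'm set"
  Ident :: "'o \<Rightarrow> 'm"
  Comp :: "'o \<Rightarrow> 'o \<Rightarrow> 'o \<Rightarrow> 'm \<Rightarrow> 'm \<Rightarrow> 'm"

locale is_category =
  fixes C :: "('o, 'm) category"
  assumes ident_closed: "X \<in> Ob C \<Longrightarrow> Ident C X \<in> Hom C X X"
    and comp_closed: "\<lbrakk>X \<in> Ob C; Y \<in> Ob C; Z \<in> Ob C; f \<in> Hom C X Y; g \<in> Hom C Y Z\<rbrakk>
      \<Longrightarrow> Comp C X Y Z g f \<in> Hom C X Z"
    and ident_left: "\<lbrakk>X \<in> Ob C; Y \<in> Ob C; f \<in> Hom C X Y\<rbrakk> \<Longrightarrow> Comp C X Y Y (Ident C Y) f = f"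
    and ident_right: "\<lbrakk>X \<in> Ob C; Y \<in> Ob C; f \<in> Hom C X Y\<rbrakk> \<Longrightarrow> Comp C X X Y f (Ident C X) = f"
    and comp_assoc: "\<lbrakk>W \<in> Ob C; X \<in> Ob C; Y \<in> Ob C; Z \<in> Ob C;
        f \<in> Hom C W X; g \<in> Hom C X Y; h \<in> Hom C Y Z\<rbrakk>
      \<Longrightarrow> Comp C W X Z (Comp C X Y Z h g) f = Comp C W Y Z h (Comp C W X Y g f)"

locale is_functor = dom: is_category C + cod: is_category D
  for C :: "('o, 'm) category" and D :: "('p, 'n) category" +
  fixes Fo :: "'o \<Rightarrow> 'p" and Fm :: "'o \<Rightarrow> 'o \<Rightarrow> 'm \<Rightarrow> 'n"
  assumes ob_closed: "X \<in> Ob C \<Longrightarrow> Fo X \<in> Ob D"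
    and hom_closed: "\<lbrakk>X \<in> Ob C; Y \<in> Ob C; f \<in> Hom C X Y\<rbrakk> \<Longrightarrow> Fm X Y f \<in> Hom D (Fo X) (Fo Y)"
    and preserves_ident: "X \<in> Ob C \<Longrightarrow> Fm X X (Ident C X) = Ident D (Fo X)"
    and preserves_comp: "\<lbrakk>X \<in> Ob C; Y \<in> Ob C; Z \<in> Ob C; f \<in> Hom C X Y; g \<in> Hom C Y Z\<rbrakk>
      \<Longrightarrow> Fm X Z (Comp C X Y Z g f) = Comp D (Fo X) (Fo Y) (Fo Z) (Fm Y Z g) (Fm X Y f)"


section \<open>Globular sets and strict omega-categories\<close>

datatype sign = Minus | Plus

text \<open>\<open>cells X n\<close> is the set of \<open>n\<close>-cells (sets of cells of different dimensions may overlap), and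
  \<open>bnd X n k \<alpha>\<close> is the source or target map from \<open>n\<close>-cells to \<open>k\<close>-cells, meaningful
  for \<open>k < n\<close>.\<close>

record 'c globset =
  cells :: "nat \<Rightarrow> 'c set"
  bnd :: "nat \<Rightarrow> nat \<Rightarrow> sign \<Rightarrow> 'c \<Rightarrow> 'c"

locale globular_set =
  fixes X :: "('c, 'z) globset_scheme"
  assumes bnd_closed: "\<lbrakk>k < n; x \<in> cells X n\<rbrakk> \<Longrightarrow> bnd X n k \<alpha> x \<in> cells X k"
    and bnd_bnd: "\<lbrakk>j < k; k < n; x \<in> cells X n\<rbrakk>
      \<Longrightarrow> bnd X k j \<beta> (bnd X n k \<alpha> x) = bnd X n j \<beta> x"

text \<open>\<open>ocomp X n k x y\<close> is \<open>x *\<^sub>k y\<close> for \<open>n\<close>-cells \<open>x\<close>, \<open>y\<close>; \<open>ounit X n m x\<close> is the \<open>n\<close>-cell \<open>x\<close>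
  regarded as a cell of dimension \<open>m > n\<close>.\<close>

record 'c omega_data = "'c globset" +
  ocomp :: "nat \<Rightarrow> nat \<Rightarrow> 'c \<Rightarrow> 'c \<Rightarrow> 'c"
  ounit :: "nat \<Rightarrow> nat \<Rightarrow> 'c \<Rightarrow> 'c"

definition composable :: "('c, 'z) globset_scheme \<Rightarrow> nat \<Rightarrow> nat \<Rightarrow> 'c \<Rightarrow> 'c \<Rightarrow> bool" where
  "composable X n k x y \<longleftrightarrow>
     k < n \<and> x \<in> cells X n \<and> y \<in> cells X n \<and> bnd X n k Minus x = bnd X n k Plus y"

locale omega_category = globular_set X
  for X :: "('c, 'z) omega_data_scheme" +
  assumes comp_closed: "composable X n k x y \<Longrightarrow> ocomp X n k x y \<in> cells X n"
    and bnd_comp_below: "\<lbrakk>composable X n k x y; j < k\<rbrakk>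
      \<Longrightarrow> bnd X n j \<alpha> (ocomp X n k x y) = bnd X n j \<alpha> x"
    and source_comp: "composable X n k x y \<Longrightarrow> bnd X n k Minus (ocomp X n k x y) = bnd X n k Minus y"
    and target_comp: "composable X n k x y \<Longrightarrow> bnd X n k Plus (ocomp X n k x y) = bnd X n k Plus x"
    and bnd_comp_above: "\<lbrakk>composable X n k x y; k < j; j < n\<rbrakk>
      \<Longrightarrow> bnd X n j \<alpha> (ocomp X n k x y) = ocomp X j k (bnd X n j \<alpha> x) (bnd X n j \<alpha> y)"
    and unit_closed: "\<lbrakk>n < m; x \<in> cells X n\<rbrakk> \<Longrightarrow> ounit X n m x \<in> cells X m"
    and bnd_unit_below: "\<lbrakk>j < n; n < m; x \<in> cells X n\<rbrakk>
      \<Longrightarrow> bnd X m j \<alpha> (ounit X n m x) = bnd X n j \<alpha> x"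
    and bnd_unit_same: "\<lbrakk>n < m; x \<in> cells X n\<rbrakk> \<Longrightarrow> bnd X m n \<alpha> (ounit X n m x) = x"
    and bnd_unit_above: "\<lbrakk>n < j; j < m; x \<in> cells X n\<rbrakk>
      \<Longrightarrow> bnd X m j \<alpha> (ounit X n m x) = ounit X n j x"
    and unit_unit: "\<lbrakk>k < n; n < m; x \<in> cells X k\<rbrakk>
      \<Longrightarrow> ounit X n m (ounit X k n x) = ounit X k m x"
    and unit_right: "\<lbrakk>k < n; x \<in> cells X n\<rbrakk>
      \<Longrightarrow> ocomp X n k x (ounit X k n (bnd X n k Minus x)) = x"
    and unit_left: "\<lbrakk>k < n; x \<in> cells X n\<rbrakk>
      \<Longrightarrow> ocomp X n k (ounit X k n (bnd X n k Plus x)) x = x"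
    and unit_comp: "\<lbrakk>composable X n k x y; n < m\<rbrakk>
      \<Longrightarrow> ounit X n m (ocomp X n k x y) = ocomp X m k (ounit X n m x) (ounit X n m y)"
    and comp_assoc: "\<lbrakk>composable X n k x y; composable X n k y z\<rbrakk>
      \<Longrightarrow> ocomp X n k (ocomp X n k x y) z = ocomp X n k x (ocomp X n k y z)"
    and exchange: "\<lbrakk>j < k; composable X n k x y; composable X n k z w;
        composable X n j x z; composable X n j y w\<rbrakk>
      \<Longrightarrow> ocomp X n j (ocomp X n k x y) (ocomp X n k z w) =
          ocomp X n k (ocomp X n j x z) (ocomp X n j y w)"

locale globular_map =
  fixes X :: "('c, 'z) globset_scheme" and Y :: "('d, 'w) globset_scheme"
    and F :: "nat \<Rightarrow> 'c \<Rightarrow> 'd"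
  assumes maps_cells: "F n \<in> cells X n \<rightarrow>\<^sub>E cells Y n"
    and map_bnd: "\<lbrakk>k < n; x \<in> cells X n\<rbrakk> \<Longrightarrow> F k (bnd X n k \<alpha> x) = bnd Y n k \<alpha> (F n x)"

locale omega_functor = globular_map X Y F
  for X :: "('c, 'z) omega_data_scheme" and Y :: "('d, 'w) omega_data_scheme"
    and F :: "nat \<Rightarrow> 'c \<Rightarrow> 'd" +
  assumes map_comp: "composable X n k x y
      \<Longrightarrow> F n (ocomp X n k x y) = ocomp Y n k (F n x) (F n y)"
    and map_unit: "\<lbrakk>n < m; x \<in> cells X n\<rbrakk> \<Longrightarrow> F m (ounit X n m x) = ounit Y n m (F n x)"

definition cells_id :: "('c, 'z) globset_scheme \<Rightarrow> nat \<Rightarrow> 'c \<Rightarrow> 'c" where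
  "cells_id X n = (\<lambda>x\<in>cells X n. x)"

definition cells_compose ::
  "('c, 'z) globset_scheme \<Rightarrow> (nat \<Rightarrow> 'd \<Rightarrow> 'e) \<Rightarrow> (nat \<Rightarrow> 'c \<Rightarrow> 'd) \<Rightarrow> nat \<Rightarrow> 'c \<Rightarrow> 'e" where
  "cells_compose X G F n = compose (cells X n) (G n) (F n)"

definition omega_iso ::
  "('c, 'z) omega_data_scheme \<Rightarrow> ('d, 'w) omega_data_scheme \<Rightarrow> (nat \<Rightarrow> 'c \<Rightarrow> 'd) \<Rightarrow> bool" where
  "omega_iso X Y F \<longleftrightarrow> omega_functor X Y F \<and>
     (\<exists>G. omega_functor Y X G \<and> cells_compose X G F = cells_id X \<and> cells_compose Y F G = cells_id Y)"

definition Glob :: "('c globset, nat \<Rightarrow> 'c \<Rightarrow> 'c) category" where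
  "Glob = \<lparr>Ob = {X. globular_set X}, Hom = (\<lambda>X Y. {F. globular_map X Y F}),
           Ident = cells_id, Comp = (\<lambda>X Y Z. cells_compose X)\<rparr>"

definition Omega_Cat :: "('c omega_data, nat \<Rightarrow> 'c \<Rightarrow> 'c) category" where
  "Omega_Cat = \<lparr>Ob = {X. omega_category X}, Hom = (\<lambda>X Y. {F. omega_functor X Y F}),
                Ident = cells_id, Comp = (\<lambda>X Y Z. cells_compose X)\<rparr>"

text \<open>\<open>Glob\<close> and \<open>Omega_Cat\<close> have the cells of all their objects in one type \<open>'c\<close>, the universe. Two
  functors may therefore land in copies of \<open>Omega_Cat\<close> over different universes, so the components
  of a natural isomorphism are allowed to relate omega-categories over different types.\<close>

definition omega_functors_isomorphic ::
  "('o, 'm) category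
   \<Rightarrow> ('o \<Rightarrow> 'c omega_data) \<Rightarrow> ('o \<Rightarrow> 'o \<Rightarrow> 'm \<Rightarrow> nat \<Rightarrow> 'c \<Rightarrow> 'c)
   \<Rightarrow> ('o \<Rightarrow> 'd omega_data) \<Rightarrow> ('o \<Rightarrow> 'o \<Rightarrow> 'm \<Rightarrow> nat \<Rightarrow> 'd \<Rightarrow> 'd) \<Rightarrow> bool" where
  "omega_functors_isomorphic C Fo Fm Go Gm \<longleftrightarrow>
     is_functor C Omega_Cat Fo Fm \<and> is_functor C Omega_Cat Go Gm \<and>
     (\<exists>\<eta>. (\<forall>X\<in>Ob C. omega_iso (Fo X) (Go X) (\<eta> X)) \<and>
          (\<forall>X\<in>Ob C. \<forall>Y\<in>Ob C. \<forall>f\<in>Hom C X Y.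
             cells_compose (Fo X) (\<eta> Y) (Fm X Y f) = cells_compose (Fo X) (Gm X Y f) (\<eta> X)))"


section \<open>Augmented directed complexes\<close>

text \<open>As usual in \<open>HOL-Algebra\<close>, the abelian groups are written multiplicatively. \<open>diff K n\<close> is
  \<open>\<partial>\<^sub>n\<close>, going from degree \<open>n + 1\<close> to degree \<open>n\<close>.\<close>

record 'a adc =
  grp :: "nat \<Rightarrow> 'a monoid"
  pos :: "nat \<Rightarrow> 'a set"
  diff :: "nat \<Rightarrow> 'a \<Rightarrow> 'a"
  aug :: "'a \<Rightarrow> int"

locale augmented_directed_complex =
  fixes K :: "'a adc"
  assumes grp_comm: "comm_group (grp K n)"
    and pos_submonoid: "submonoid (pos K n) (grp K n)"
    and diff_hom: "diff K n \<in> hom (grp K (Suc n)) (grp K n)"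
    and diff_diff: "x \<in> carrier (grp K (Suc (Suc n))) \<Longrightarrow> diff K n (diff K (Suc n) x) = \<one>\<^bsub>grp K n\<^esub>"
    and aug_hom: "aug K \<in> hom (grp K 0) integer_group"
    and aug_diff: "x \<in> carrier (grp K (Suc 0)) \<Longrightarrow> aug K (diff K 0 x) = 0"

locale adc_morphism =
  fixes K :: "'a adc" and L :: "'b adc" and f :: "nat \<Rightarrow> 'a \<Rightarrow> 'b"
  assumes f_hom: "f n \<in> hom (grp K n) (grp L n)"
    and f_extensional: "f n \<in> extensional (carrier (grp K n))"
    and f_diff: "x \<in> carrier (grp K (Suc n)) \<Longrightarrow> f n (diff K n x) = diff L n (f (Suc n) x)"
    and f_aug: "x \<in> carrier (grp K 0) \<Longrightarrow> aug L (f 0 x) = aug K x"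
    and f_pos: "f n ` pos K n \<subseteq> pos L n"


subsection \<open>Bases\<close>

definition lincomb :: "('a, 'z) monoid_scheme \<Rightarrow> ('a \<Rightarrow>\<^sub>0 int) \<Rightarrow> 'a" where
  "lincomb G c = (\<Otimes>\<^bsub>G\<^esub>b\<in>Poly_Mapping.keys c. b [^]\<^bsub>G\<^esub> Poly_Mapping.lookup c b)"

definition nonneg :: "('a \<Rightarrow>\<^sub>0 int) \<Rightarrow> bool" where
  "nonneg c \<longleftrightarrow> (\<forall>b. 0 \<le> Poly_Mapping.lookup c b)"

definition group_basis :: "('a, 'z) monoid_scheme \<Rightarrow> 'a set \<Rightarrow> bool" where
  "group_basis G B \<longleftrightarrow> B \<subseteq> carrier G \<and>
     (\<forall>x\<in>carrier G. \<exists>!c. Poly_Mapping.keys c \<subseteq> B \<and> lincomb G c = x)"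

definition submonoid_basis :: "('a, 'z) monoid_scheme \<Rightarrow> 'a set \<Rightarrow> 'a set \<Rightarrow> bool" where
  "submonoid_basis G M B \<longleftrightarrow> B \<subseteq> M \<and>
     (\<forall>x\<in>M. \<exists>!c. Poly_Mapping.keys c \<subseteq> B \<and> nonneg c \<and> lincomb G c = x)"

definition is_basis :: "'a adc \<Rightarrow> (nat \<Rightarrow> 'a set) \<Rightarrow> bool" where
  "is_basis K B \<longleftrightarrow> (\<forall>n. group_basis (grp K n) (B n) \<and> submonoid_basis (grp K n) (pos K n) (B n))"

definition coords :: "'a adc \<Rightarrow> (nat \<Rightarrow> 'a set) \<Rightarrow> nat \<Rightarrow> 'a \<Rightarrow> ('a \<Rightarrow>\<^sub>0 int)" where
  "coords K B n x = (THE c. Poly_Mapping.keys c \<subseteq> B n \<and> lincomb (grp K n) c = x)"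

fun signed_part :: "sign \<Rightarrow> ('a \<Rightarrow>\<^sub>0 int) \<Rightarrow> ('a \<Rightarrow>\<^sub>0 int)" where
  "signed_part Plus c = Poly_Mapping.map (\<lambda>i. max i 0) c"
| "signed_part Minus c = Poly_Mapping.map (\<lambda>i. max (- i) 0) c"

definition coeff_min :: "('a \<Rightarrow>\<^sub>0 int) \<Rightarrow> ('a \<Rightarrow>\<^sub>0 int) \<Rightarrow> ('a \<Rightarrow>\<^sub>0 int)" where
  "coeff_min c c' =
     Poly_Mapping.Abs_poly_mapping (\<lambda>b. min (Poly_Mapping.lookup c b) (Poly_Mapping.lookup c' b))"

definition signed_diff :: "'a adc \<Rightarrow> (nat \<Rightarrow> 'a set) \<Rightarrow> sign \<Rightarrow> nat \<Rightarrow> 'a \<Rightarrow> 'a" where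
  "signed_diff K B \<alpha> n x = lincomb (grp K n) (signed_part \<alpha> (coords K B n (diff K n x)))"

text \<open>\<open>bracket K B \<alpha> n a k\<close> is \<open>\<langle>a\<rangle>\<close> with superscript \<open>\<alpha>\<close> and subscript \<open>k\<close>, for \<open>a\<close> of
  degree \<open>n\<close> and \<open>k \<le> n\<close>.\<close>

function bracket :: "'a adc \<Rightarrow> (nat \<Rightarrow> 'a set) \<Rightarrow> sign \<Rightarrow> nat \<Rightarrow> 'a \<Rightarrow> nat \<Rightarrow> 'a" where
  "bracket K B \<alpha> n a k =
     (if n \<le> k then a else signed_diff K B \<alpha> k (bracket K B \<alpha> n a (Suc k)))"
  by pat_completeness auto
termination by (relation "measure (\<lambda>(K, B, \<alpha>, n, a, k). n - k)") auto

declare bracket.simps [simp del]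

definition unitary :: "'a adc \<Rightarrow> (nat \<Rightarrow> 'a set) \<Rightarrow> bool" where
  "unitary K B \<longleftrightarrow> (\<forall>n. \<forall>b\<in>B n. \<forall>\<alpha>. aug K (bracket K B \<alpha> n b 0) = 1)"

text \<open>Elements of the graded set \<open>B\<close> are pairs (degree, element).\<close>

definition odot_gen :: "'a adc \<Rightarrow> (nat \<Rightarrow> 'a set) \<Rightarrow> nat \<Rightarrow> ((nat \<times> 'a) \<times> (nat \<times> 'a)) set" where
  "odot_gen K B n = {((p, a), (q, b)). a \<in> B p \<and> b \<in> B q \<and> n \<le> p \<and> n \<le> q \<and>
     coeff_min (coords K B n (bracket K B Minus p a n)) (coords K B n (bracket K B Plus q b n)) \<noteq> 0}"

definition odot :: "'a adc \<Rightarrow> (nat \<Rightarrow> 'a set) \<Rightarrow> nat \<Rightarrow> ((nat \<times> 'a) \<times> (nat \<times> 'a)) set" where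
  "odot K B n = (odot_gen K B n)\<^sup>* \<inter> (Sigma UNIV B \<times> Sigma UNIV B)"

definition loop_free :: "'a adc \<Rightarrow> (nat \<Rightarrow> 'a set) \<Rightarrow> bool" where
  "loop_free K B \<longleftrightarrow> (\<forall>n. partial_order_on (Sigma UNIV B) (odot K B n))"

definition unitary_loop_free_basis :: "'a adc \<Rightarrow> (nat \<Rightarrow> 'a set) \<Rightarrow> bool" where
  "unitary_loop_free_basis K B \<longleftrightarrow> is_basis K B \<and> unitary K B \<and> loop_free K B"

definition the_basis :: "'a adc \<Rightarrow> nat \<Rightarrow> 'a set" where
  "the_basis K = (THE B. unitary_loop_free_basis K B)"

definition CDA_B :: "('a adc, nat \<Rightarrow> 'a \<Rightarrow> 'a) category" where
  "CDA_B = \<lparr>Ob = {K. augmented_directed_complex K \<and> (\<exists>B. unitary_loop_free_basis K B)},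
            Hom = (\<lambda>K L. {f. adc_morphism K L f}),
            Ident = (\<lambda>K n. \<lambda>x\<in>carrier (grp K n). x),
            Comp = (\<lambda>K L M g f n. compose (carrier (grp K n)) (g n) (f n))\<rparr>"


section \<open>The functor nu\<close>

text \<open>An \<open>n\<close>-cell is a family indexed by \<open>k \<le> n\<close> and a sign; it is \<open>undefined\<close> at indices
  \<open>k > n\<close>.\<close>

type_synonym 'a table = "nat \<Rightarrow> sign \<Rightarrow> 'a"

definition nu_cells :: "'a adc \<Rightarrow> nat \<Rightarrow> 'a table set" where
  "nu_cells K n = {x.
     (\<forall>k\<le>n. \<forall>\<alpha>. x k \<alpha> \<in> pos K k) \<and> (\<forall>k>n. \<forall>\<alpha>. x k \<alpha> = undefined) \<and>
     x n Minus = x n Plus \<and>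
     (\<forall>k<n. \<forall>\<alpha>. diff K k (x (Suc k) \<alpha>) = x k Plus \<otimes>\<^bsub>grp K k\<^esub> inv\<^bsub>grp K k\<^esub> (x k Minus)) \<and>
     (\<forall>\<alpha>. aug K (x 0 \<alpha>) = 1)}"

definition nu_bnd :: "nat \<Rightarrow> nat \<Rightarrow> sign \<Rightarrow> 'a table \<Rightarrow> 'a table" where
  "nu_bnd n k \<alpha> x = (\<lambda>i \<beta>. if i < k then x i \<beta> else if i = k then x k \<alpha> else undefined)"

definition nu_unit :: "'a adc \<Rightarrow> nat \<Rightarrow> nat \<Rightarrow> 'a table \<Rightarrow> 'a table" where
  "nu_unit K n m x =
     (\<lambda>i \<beta>. if i \<le> n then x i \<beta> else if i \<le> m then \<one>\<^bsub>grp K i\<^esub> else undefined)"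

definition nu_comp :: "'a adc \<Rightarrow> nat \<Rightarrow> nat \<Rightarrow> 'a table \<Rightarrow> 'a table \<Rightarrow> 'a table" where
  "nu_comp K n k x y =
     (let z = nu_unit K k n (nu_bnd n k Minus x)
      in (\<lambda>i \<beta>. if i \<le> n
                then x i \<beta> \<otimes>\<^bsub>grp K i\<^esub> inv\<^bsub>grp K i\<^esub> (z i \<beta>) \<otimes>\<^bsub>grp K i\<^esub> y i \<beta>
                else undefined))"

definition nu :: "'a adc \<Rightarrow> 'a table omega_data" where
  "nu K = \<lparr>cells = nu_cells K, bnd = nu_bnd, ocomp = nu_comp K, ounit = nu_unit K\<rparr>"

definition nu_map ::
  "'a adc \<Rightarrow> 'b adc \<Rightarrow> (nat \<Rightarrow> 'a \<Rightarrow> 'b) \<Rightarrow> nat \<Rightarrow> 'a table \<Rightarrow> 'b table" where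
  "nu_map K L f n =
     (\<lambda>x\<in>nu_cells K n. (\<lambda>k \<alpha>. if k \<le> n then f k (x k \<alpha>) else undefined))"


section \<open>Chains and the functor mu\<close>

text \<open>A formal integral combination of basis elements is stored by degree: for \<open>a :: 'a fsum\<close>,
  \<open>lookup a k\<close> is its part \<open>(a)\<^sub>k\<close> of degree \<open>k\<close>.\<close>

type_synonym 'a fsum = "nat \<Rightarrow>\<^sub>0 ('a \<Rightarrow>\<^sub>0 int)"

definition is_chain :: "(nat \<Rightarrow> 'a set) \<Rightarrow> 'a fsum \<Rightarrow> bool" where
  "is_chain B a \<longleftrightarrow>
     (\<forall>k. Poly_Mapping.keys (Poly_Mapping.lookup a k) \<subseteq> B k \<and> nonneg (Poly_Mapping.lookup a k))"

definition cdeg :: "'a fsum \<Rightarrow> int" where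
  "cdeg a = (if a = 0 then - 1 else int (Max (Poly_Mapping.keys a)))"

definition part_elt :: "'a adc \<Rightarrow> nat \<Rightarrow> 'a fsum \<Rightarrow> 'a" where
  "part_elt K k a = lincomb (grp K k) (Poly_Mapping.lookup a k)"

definition elt_sum :: "'a adc \<Rightarrow> (nat \<Rightarrow> 'a set) \<Rightarrow> nat \<Rightarrow> 'a \<Rightarrow> 'a fsum" where
  "elt_sum K B k x = Poly_Mapping.single k (coords K B k x)"

definition truncation :: "nat \<Rightarrow> 'a fsum \<Rightarrow> 'a fsum" where
  "truncation k a = (\<Sum>i\<le>k. Poly_Mapping.single i (Poly_Mapping.lookup a i))"

definition pos_fsum :: "'a fsum \<Rightarrow> 'a fsum" where
  "pos_fsum a = Poly_Mapping.map (signed_part Plus) a"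

function chain_bnd ::
  "'a adc \<Rightarrow> (nat \<Rightarrow> 'a set) \<Rightarrow> sign \<Rightarrow> nat \<Rightarrow> 'a fsum \<Rightarrow> 'a fsum" where
  "chain_bnd K B \<alpha> n a =
     (if cdeg a \<le> int n then a
      else elt_sum K B n (signed_diff K B \<alpha> n (part_elt K (Suc n) (chain_bnd K B \<alpha> (Suc n) a)))
           + truncation n (chain_bnd K B \<alpha> (Suc n) a))"
  by pat_completeness auto
termination by (relation "measure (\<lambda>(K, B, \<alpha>, n, a). nat (cdeg a - int n))") auto

declare chain_bnd.simps [simp del]

definition coherent :: "'a adc \<Rightarrow> (nat \<Rightarrow> 'a set) \<Rightarrow> 'a fsum \<Rightarrow> bool" where
  "coherent K B a \<longleftrightarrow> (\<forall>\<alpha>. aug K (part_elt K 0 (chain_bnd K B \<alpha> 0 a)) = 1)"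

definition mu_cells :: "'a adc \<Rightarrow> nat \<Rightarrow> 'a fsum set" where
  "mu_cells K n =
     {a. is_chain (the_basis K) a \<and> cdeg a \<le> int n \<and> coherent K (the_basis K) a}"

definition mu_glob :: "'a adc \<Rightarrow> 'a fsum globset" where
  "mu_glob K = \<lparr>cells = mu_cells K, bnd = (\<lambda>n k \<alpha>. chain_bnd K (the_basis K) \<alpha> k)\<rparr>"

definition mu_comp :: "'a adc \<Rightarrow> nat \<Rightarrow> nat \<Rightarrow> 'a fsum \<Rightarrow> 'a fsum \<Rightarrow> 'a fsum" where
  "mu_comp K n k a a' = (let c = chain_bnd K (the_basis K) Minus k a in pos_fsum (a - c + a'))"

definition mu :: "'a adc \<Rightarrow> 'a fsum omega_data" where
  "mu K = \<lparr>cells = cells (mu_glob K), bnd = bnd (mu_glob K),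
           ocomp = mu_comp K, ounit = (\<lambda>n m a. a)\<rparr>"

definition phi :: "'a adc \<Rightarrow> nat \<Rightarrow> 'a table \<Rightarrow> 'a fsum" where
  "phi K n x =
     elt_sum K (the_basis K) n (x n Plus) +
     (\<Sum>k<n. elt_sum K (the_basis K) k (x k Plus) -
             elt_sum K (the_basis K) k (signed_diff K (the_basis K) Plus k (x (Suc k) Plus)))"

definition psi :: "'a adc \<Rightarrow> nat \<Rightarrow> 'a fsum \<Rightarrow> 'a table" where
  "psi K n a =
     (\<lambda>k \<alpha>. if k \<le> n then part_elt K k (chain_bnd K (the_basis K) \<alpha> k a) else undefined)"

definition mu_map ::
  "'a adc \<Rightarrow> 'b adc \<Rightarrow> (nat \<Rightarrow> 'a \<Rightarrow> 'b) \<Rightarrow> nat \<Rightarrow> 'a fsum \<Rightarrow> 'b fsum" where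
  "mu_map K L f n = (\<lambda>a\<in>mu_cells K n. phi L n (nu_map K L f n (psi K n a)))"

end

(* The whole argument rests on one fact: in a cell x of nu K all coefficients of the x_k are 0 or 1.
   A (r+1)-cell can be cut along a subset of its top-dimensional basis elements that is closed under
   the loop-free relation of degree r, and the cut is again an r-cell. Cutting just before and just
   after a basis element b that occurs with multiplicity m shows that the cut before b contains the
   (nonzero) source of b at least m times, so m <= 1 by induction on the dimension.

   Consequently two k-composable cells have disjoint supports above degree k, because the composite
   is their sum there; and a basis element of degree k that is consumed by the first cell is not
   produced again by the second, because cutting the composite after the producer would give it
   coefficient 2. Since the degree i part of phi(x) is the coefficientwise minimum of x_i^+ and
   x_i^-, these facts are exactly what makes phi compatible with the compositions, and the structure
   of nu K is transported to mu K. *)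

theory Submission
  imports Defs
begin

text \<open>The obstacle is that the composition of chains is not linear, because of the positive
  part. At a basis element of degree k, let p, q, r be its coefficients in the target of the second
  cell, in the common boundary and in the source of the first cell. The composite in
  \<open>nu K\<close> gives the chain coefficient \<open>min p r\<close>, while the formula for
  chains gives the positive part of \<open>min p q - q + min q r\<close>. These differ for p = r = 1
  and q = 2, which the bound by 1 excludes, and for p = r = 1 and q = 0, which is the return of a
  consumed element. For all other values in {0, 1} they agree. Above degree k the formula is a plain
  sum, so there the minimum has to be additive, and disjointness of supports provides this.

  Unitarity serves the bound in two ways: in degree 0 it makes the coefficients of a cell sum to 1,
  and in higher degrees it rules out basis elements with zero source, about whose multiplicity the
  preceding cut would say nothing.

  The laws are checked in \<open>nu K\<close>, where each is an identity of abelian groups in every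
  entry, and never on chains.\<close>

section \<open>Coordinates with respect to a basis\<close>

lemma (in comm_group) lincomb_superset:
  assumes "Poly_Mapping.keys c \<subseteq> S" "finite S" "S \<subseteq> carrier G"
  shows "lincomb G c = (\<Otimes>b\<in>S. b [^] Poly_Mapping.lookup c b)"
  unfolding lincomb_def
  by (rule finprod_mono_neutral_cong_left)
     (use assms in \<open>auto simp: in_keys_iff\<close>)

lemma (in comm_group) lincomb_closed:
  "Poly_Mapping.keys c \<subseteq> carrier G \<Longrightarrow> lincomb G c \<in> carrier G"
  unfolding lincomb_def by (rule finprod_closed) auto

lemma (in comm_group) lincomb_zero [simp]: "lincomb G 0 = \<one>"
  by (simp add: lincomb_def)

lemma (in comm_group) lincomb_single:
  "b \<in> carrier G \<Longrightarrow> lincomb G (Poly_Mapping.single b 1) = b"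
  by (simp add: lincomb_def)

lemma (in comm_group) lincomb_add:
  assumes "Poly_Mapping.keys c \<subseteq> carrier G" "Poly_Mapping.keys c' \<subseteq> carrier G"
  shows "lincomb G (c + c') = lincomb G c \<otimes> lincomb G c'"
proof -
  let ?S = "Poly_Mapping.keys c \<union> Poly_Mapping.keys c'"
  have S: "finite ?S" "?S \<subseteq> carrier G"
    using assms by auto
  have "lincomb G (c + c') = (\<Otimes>b\<in>?S. b [^] Poly_Mapping.lookup (c + c') b)"
    using S Poly_Mapping.keys_add[of c c'] by (intro lincomb_superset) auto
  also have "\<dots> = (\<Otimes>b\<in>?S. b [^] Poly_Mapping.lookup c b \<otimes> b [^] Poly_Mapping.lookup c' b)"
    using S by (intro finprod_cong') (auto simp: lookup_add int_pow_mult)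
  also have "\<dots> = (\<Otimes>b\<in>?S. b [^] Poly_Mapping.lookup c b) \<otimes> (\<Otimes>b\<in>?S. b [^] Poly_Mapping.lookup c' b)"
    using S by (intro finprod_multf) auto
  also have "\<dots> = lincomb G c \<otimes> lincomb G c'"
    using S lincomb_superset[of c ?S] lincomb_superset[of c' ?S] by simp
  finally show ?thesis .
qed

lemma (in comm_group) lincomb_nonneg_mem:
  assumes M: "submonoid M G" and keys: "Poly_Mapping.keys c \<subseteq> M" and pos: "nonneg c"
  shows "lincomb G c \<in> M"
proof -
  interpret M: submonoid M G by (rule M)
  have pow: "b [^] m \<in> M" if "b \<in> M" "0 \<le> m" for b and m :: int
  proof -
    have "b [^] (k :: nat) \<in> M" for k
      by (induction k) (use that in auto)
    then show ?thesis
      using that(2) by (metis int_pow_int zero_le_imp_eq_int)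
  qed
  have "(\<Otimes>b\<in>S. b [^] Poly_Mapping.lookup c b) \<in> M" if "finite S" "S \<subseteq> M" for S
    using that
  proof (induction S rule: finite_induct)
    case (insert b S)
    have "(\<lambda>b. b [^] Poly_Mapping.lookup c b) \<in> S \<rightarrow> carrier G" "b \<in> carrier G"
      using insert.prems M.subset by auto
    then show ?case
      using insert pos pow by (simp add: nonneg_def)
  qed auto
  then show ?thesis
    unfolding lincomb_def using keys by simp
qed

text \<open>The basis is a parameter and not \<open>the_basis K\<close>, so that two bases of one
  complex can be compared; for a unitary loop-free basis \<open>the_basis_eq\<close> identifies the
  two.\<close>

locale adc_with_basis = augmented_directed_complex K for K :: "'a adc" +
  fixes B :: "nat \<Rightarrow> 'a set"
  assumes basis: "is_basis K B"
begin

abbreviation lin :: "nat \<Rightarrow> ('a \<Rightarrow>\<^sub>0 int) \<Rightarrow> 'a" where "lin n \<equiv> lincomb (grp K n)"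
abbreviation co :: "nat \<Rightarrow> 'a \<Rightarrow> ('a \<Rightarrow>\<^sub>0 int)" where "co \<equiv> coords K B"

text \<open>The free abelian group on \<open>B n\<close>; \<open>co\<close> and \<open>lin\<close>
  are inverse isomorphisms between it and \<open>grp K n\<close>. Cells are computed with on this
  side, where addition and subtraction are total operations of a type.\<close>

definition V :: "nat \<Rightarrow> ('a \<Rightarrow>\<^sub>0 int) set" where
  "V n = {c. Poly_Mapping.keys c \<subseteq> B n}"

lemma basis_carrier: "B n \<subseteq> carrier (grp K n)"
  using basis by (simp add: is_basis_def group_basis_def)

lemma basis_pos: "B n \<subseteq> pos K n"
  using basis by (simp add: is_basis_def submonoid_basis_def)

lemma basis_ex1:
  "x \<in> carrier (grp K n) \<Longrightarrow> \<exists>!c. Poly_Mapping.keys c \<subseteq> B n \<and> lin n c = x"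
  using basis by (simp add: is_basis_def group_basis_def)

lemma basis_nonneg_ex:
  assumes "x \<in> pos K n"
  obtains c where "Poly_Mapping.keys c \<subseteq> B n" "nonneg c" "lin n c = x"
  using basis assms unfolding is_basis_def submonoid_basis_def by metis

lemma is_group: "group (grp K n)"
  using grp_comm by (rule comm_group.axioms(2))

lemma V_zero [simp]: "0 \<in> V n"
  by (simp add: V_def)

lemma V_add [simp]: "c \<in> V n \<Longrightarrow> c' \<in> V n \<Longrightarrow> c + c' \<in> V n"
  unfolding V_def using Poly_Mapping.keys_add[of c c'] by blast

lemma V_minus [simp]: "c \<in> V n \<Longrightarrow> c' \<in> V n \<Longrightarrow> c - c' \<in> V n"
  unfolding V_def using keys_diff[of c c'] by blast

lemma V_single [simp]: "b \<in> B n \<Longrightarrow> Poly_Mapping.single b m \<in> V n"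
  by (simp add: V_def)

lemma V_sum [simp]: "(\<And>i. i \<in> I \<Longrightarrow> g i \<in> V n) \<Longrightarrow> sum g I \<in> V n"
  by (induction I rule: infinite_finite_induct) auto

lemma lin_closed [simp]: "c \<in> V n \<Longrightarrow> lin n c \<in> carrier (grp K n)"
  unfolding V_def using basis_carrier by (intro comm_group.lincomb_closed[OF grp_comm]) auto

lemma co_lin [simp]: "c \<in> V n \<Longrightarrow> co n (lin n c) = c"
  using basis_ex1[of "lin n c" n] lin_closed[of c n]
  unfolding coords_def V_def by (intro the1_equality) auto

lemma co_V [simp]: "x \<in> carrier (grp K n) \<Longrightarrow> co n x \<in> V n"
  and lin_co [simp]: "x \<in> carrier (grp K n) \<Longrightarrow> lin n (co n x) = x"
  using theI'[OF basis_ex1[of x n]] unfolding coords_def V_def by auto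

lemma lin_add: "c \<in> V n \<Longrightarrow> c' \<in> V n \<Longrightarrow> lin n (c + c') = lin n c \<otimes>\<^bsub>grp K n\<^esub> lin n c'"
  unfolding V_def using basis_carrier by (intro comm_group.lincomb_add[OF grp_comm]) auto

lemma lin_zero [simp]: "lin n 0 = \<one>\<^bsub>grp K n\<^esub>"
  by (rule comm_group.lincomb_zero[OF grp_comm])

lemma lin_single [simp]: "b \<in> B n \<Longrightarrow> lin n (Poly_Mapping.single b 1) = b"
  using basis_carrier by (intro comm_group.lincomb_single[OF grp_comm]) auto

lemma co_mult:
  assumes "x \<in> carrier (grp K n)" "y \<in> carrier (grp K n)"
  shows "co n (x \<otimes>\<^bsub>grp K n\<^esub> y) = co n x + co n y"
  using assms lin_add[of "co n x" n "co n y"] co_lin[of "co n x + co n y" n] by simp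

lemma co_one [simp]: "co n \<one>\<^bsub>grp K n\<^esub> = 0"
  using co_lin[of 0 n] by simp

lemma co_basis [simp]: "b \<in> B n \<Longrightarrow> co n b = Poly_Mapping.single b 1"
  using co_lin[of "Poly_Mapping.single b 1" n] by simp

lemma co_inject:
  "x \<in> carrier (grp K n) \<Longrightarrow> y \<in> carrier (grp K n) \<Longrightarrow> co n x = co n y \<longleftrightarrow> x = y"
  by (metis lin_co)

text \<open>An expansion in the monoid is also an expansion in the group, where coordinates are
  unique, so the nonnegative one must be \<open>co n x\<close>.\<close>

lemma pos_iff: "x \<in> pos K n \<longleftrightarrow> x \<in> carrier (grp K n) \<and> nonneg (co n x)"
proof
  assume "x \<in> pos K n"
  then obtain c where "c \<in> V n" "nonneg c" "lin n c = x"
    using basis_nonneg_ex unfolding V_def by blast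
  then show "x \<in> carrier (grp K n) \<and> nonneg (co n x)"
    by auto
next
  assume x: "x \<in> carrier (grp K n) \<and> nonneg (co n x)"
  then have "Poly_Mapping.keys (co n x) \<subseteq> pos K n"
    using co_V[of x n] basis_pos unfolding V_def by blast
  then have "lin n (co n x) \<in> pos K n"
    using x by (intro comm_group.lincomb_nonneg_mem[OF grp_comm pos_submonoid]) auto
  then show "x \<in> pos K n" using x by simp
qed

lemma lin_pos: "c \<in> V n \<Longrightarrow> nonneg c \<Longrightarrow> lin n c \<in> pos K n"
  by (simp add: pos_iff)

text \<open>The right-hand side mentions no basis, hence bases are unique. The coordinates of a
  basis element sum to 1, so one of two nonnegative summands vanishes. Conversely, a basis element
  in the support of an atom splits off, and the remainder must be trivial.\<close>

lemma basis_eq_atoms: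
  "B n = {x \<in> pos K n. x \<noteq> \<one>\<^bsub>grp K n\<^esub> \<and>
    (\<forall>y\<in>pos K n. \<forall>z\<in>pos K n. x = y \<otimes>\<^bsub>grp K n\<^esub> z \<longrightarrow> y = \<one>\<^bsub>grp K n\<^esub> \<or> z = \<one>\<^bsub>grp K n\<^esub>)}"
    (is "_ = ?A")
proof (intro equalityI subsetI)
  fix b assume b: "b \<in> B n"
  have ne: "b \<noteq> \<one>\<^bsub>grp K n\<^esub>"
    using co_basis[OF b] co_one[of n] by (metis lookup_single_eq lookup_zero zero_neq_one)
  have "y = \<one>\<^bsub>grp K n\<^esub> \<or> z = \<one>\<^bsub>grp K n\<^esub>"
    if yz: "y \<in> pos K n" "z \<in> pos K n" "b = y \<otimes>\<^bsub>grp K n\<^esub> z" for y z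
  proof -
    have carr: "y \<in> carrier (grp K n)" "z \<in> carrier (grp K n)"
      and nn: "nonneg (co n y)" "nonneg (co n z)"
      using yz pos_iff by auto
    have eq: "Poly_Mapping.single b 1 = co n y + co n z"
      using co_basis[OF b] co_mult[OF carr] yz(3) by simp
    have l: "Poly_Mapping.lookup (co n y) t + Poly_Mapping.lookup (co n z) t = (if t = b then 1 else 0)" for t
      using arg_cong[OF eq, of "\<lambda>c. Poly_Mapping.lookup c t"]
      by (simp add: lookup_add lookup_single when_def split: if_splits)
    have nn': "0 \<le> Poly_Mapping.lookup (co n y) t" "0 \<le> Poly_Mapping.lookup (co n z) t" for t
      using nn by (auto simp: nonneg_def)
    have 0: "Poly_Mapping.lookup (co n y) t = 0" "Poly_Mapping.lookup (co n z) t = 0" if "t \<noteq> b" for t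
      using l[of t] nn'[of t] that by auto
    have "Poly_Mapping.lookup (co n y) b = 0 \<or> Poly_Mapping.lookup (co n z) b = 0"
      using l[of b] nn'[of b] by auto
    then have "co n y = 0 \<or> co n z = 0"
      using 0 by (metis lookup_zero poly_mapping_eqI)
    then show ?thesis
      using carr lin_co lin_zero by metis
  qed
  then show "b \<in> ?A"
    using b ne basis_pos by blast
next
  fix x assume x: "x \<in> ?A"
  then have xc: "x \<in> carrier (grp K n)" and nn: "nonneg (co n x)"
    using pos_iff by auto
  have "co n x \<noteq> 0"
    using x xc lin_co[of x n] lin_zero[of n] by force
  then obtain b where b: "b \<in> Poly_Mapping.keys (co n x)"
    by (metis keys_eq_empty equals0I)
  then have bB: "b \<in> B n"
    using xc co_V unfolding V_def by blast
  let ?c = "co n x - Poly_Mapping.single b 1"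
  have cV: "?c \<in> V n"
    using xc bB by simp
  have cnn: "nonneg ?c"
    using nn b unfolding nonneg_def
    by (auto simp: lookup_minus lookup_single when_def in_keys_iff)
       (metis int_one_le_iff_zero_less order_le_less)
  have "x = b \<otimes>\<^bsub>grp K n\<^esub> lin n ?c"
    using lin_add[of "Poly_Mapping.single b 1" n ?c] bB cV xc by simp
  moreover have "b \<in> pos K n" "lin n ?c \<in> pos K n"
    using bB basis_pos lin_pos[OF cV cnn] by auto
  moreover have "b \<noteq> \<one>\<^bsub>grp K n\<^esub>"
    using co_basis[OF bB] co_one[of n] by (metis lookup_single_eq lookup_zero zero_neq_one)
  ultimately have "lin n ?c = \<one>\<^bsub>grp K n\<^esub>"
    using x by blast
  then show "x \<in> B n"
    using \<open>x = b \<otimes>\<^bsub>grp K n\<^esub> lin n ?c\<close> bB basis_carrier is_group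
    by (metis group.is_monoid monoid.r_one subsetD)
qed

end

lemma is_basis_unique:
  assumes "augmented_directed_complex K" "is_basis K B" "is_basis K B'"
  shows "B = B'"
proof
  fix n
  interpret K: augmented_directed_complex K by fact
  interpret B: adc_with_basis K B by unfold_locales fact
  interpret B': adc_with_basis K B' by unfold_locales fact
  show "B n = B' n"
    by (simp only: B.basis_eq_atoms[of n] B'.basis_eq_atoms[of n])
qed

lemma the_basis_ulf:
  assumes "augmented_directed_complex K" "\<exists>B. unitary_loop_free_basis K B"
  shows "unitary_loop_free_basis K (the_basis K)"
proof -
  have "\<exists>!B. unitary_loop_free_basis K B"
    using assms is_basis_unique[OF assms(1)] unfolding unitary_loop_free_basis_def by metis
  then show ?thesis
    unfolding the_basis_def by (rule theI')
qed

section \<open>Cells in coordinates\<close>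

lemma lookup_signed_part [simp]:
  "Poly_Mapping.lookup (signed_part Plus c) b = max (Poly_Mapping.lookup c b) 0"
  "Poly_Mapping.lookup (signed_part Minus c) b = max (- Poly_Mapping.lookup c b) 0"
  by (simp_all add: Poly_Mapping.map.rep_eq when_def)

declare signed_part.simps [simp del]

lemma signed_part_zero [simp]: "signed_part \<alpha> 0 = 0"
  by (cases \<alpha>) (auto intro: poly_mapping_eqI)

lemma nonneg_signed_part [simp]: "nonneg (signed_part \<alpha> c)"
  by (cases \<alpha>) (auto simp: nonneg_def)

lemma signed_part_diff: "signed_part Plus c - signed_part Minus c = c"
  by (rule poly_mapping_eqI) (simp add: lookup_minus)

lemma keys_signed_part: "Poly_Mapping.keys (signed_part \<alpha> c) \<subseteq> Poly_Mapping.keys c"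
  by (cases \<alpha>) (auto simp: in_keys_iff)

lemma coeff_min_eq_0_iff:
  "coeff_min c c' = 0 \<longleftrightarrow> (\<forall>b. min (Poly_Mapping.lookup c b) (Poly_Mapping.lookup c' b) = 0)"
proof -
  have "finite {b. min (Poly_Mapping.lookup c b) (Poly_Mapping.lookup c' b) \<noteq> 0}"
    by (rule finite_subset[of _ "Poly_Mapping.keys c \<union> Poly_Mapping.keys c'"])
       (auto simp: in_keys_iff min_def)
  then have "Poly_Mapping.lookup (coeff_min c c') =
      (\<lambda>b. min (Poly_Mapping.lookup c b) (Poly_Mapping.lookup c' b))"
    unfolding coeff_min_def by (rule Abs_poly_mapping_inverse[OF CollectI])
  then show ?thesis
    by (metis lookup_zero poly_mapping_eqI)
qed

lemma sum_monomials:
  "(\<Sum>b\<in>Poly_Mapping.keys c. Poly_Mapping.single b (Poly_Mapping.lookup c b)) = c"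
  by (rule poly_mapping_eqI) (simp add: lookup_sum lookup_single when_def in_keys_iff)

context adc_with_basis
begin

abbreviation lk :: "('a \<Rightarrow>\<^sub>0 int) \<Rightarrow> 'a \<Rightarrow> int" where "lk \<equiv> Poly_Mapping.lookup"

definition dd :: "nat \<Rightarrow> ('a \<Rightarrow>\<^sub>0 int) \<Rightarrow> ('a \<Rightarrow>\<^sub>0 int)" where
  "dd n c = co n (diff K n (lin (Suc n) c))"

definition ee :: "('a \<Rightarrow>\<^sub>0 int) \<Rightarrow> int" where
  "ee c = aug K (lin 0 c)"

lemma diff_closed [simp]: "x \<in> carrier (grp K (Suc n)) \<Longrightarrow> diff K n x \<in> carrier (grp K n)"
  using diff_hom hom_in_carrier by fastforce

lemma dd_V [simp]: "c \<in> V (Suc n) \<Longrightarrow> dd n c \<in> V n"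
  by (simp add: dd_def)

lemma dd_add: "c \<in> V (Suc n) \<Longrightarrow> c' \<in> V (Suc n) \<Longrightarrow> dd n (c + c') = dd n c + dd n c'"
  by (simp add: dd_def lin_add hom_mult[OF diff_hom] co_mult)

lemma dd_zero [simp]: "dd n 0 = 0"
  using dd_add[of 0 n 0] by simp

lemma dd_minus: "c \<in> V (Suc n) \<Longrightarrow> c' \<in> V (Suc n) \<Longrightarrow> dd n (c - c') = dd n c - dd n c'"
  using dd_add[of "c - c'" n c'] by simp

lemma dd_dd: "c \<in> V (Suc (Suc n)) \<Longrightarrow> dd n (dd (Suc n) c) = 0"
  by (simp add: dd_def diff_diff)

lemma ee_add: "c \<in> V 0 \<Longrightarrow> c' \<in> V 0 \<Longrightarrow> ee (c + c') = ee c + ee c'"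
  by (simp add: ee_def lin_add hom_mult[OF aug_hom])

lemma ee_zero [simp]: "ee 0 = 0"
  using ee_add[of 0 0] by simp

lemma ee_dd: "c \<in> V (Suc 0) \<Longrightarrow> ee (dd 0 c) = 0"
  by (simp add: ee_def dd_def aug_diff)

lemma V_signed_part [simp]: "c \<in> V n \<Longrightarrow> signed_part \<alpha> c \<in> V n"
  using keys_signed_part[of \<alpha> c] unfolding V_def by blast

lemma co_signed_diff:
  "x \<in> carrier (grp K (Suc n)) \<Longrightarrow> co n (signed_diff K B \<alpha> n x) = signed_part \<alpha> (dd n (co (Suc n) x))"
  by (simp add: signed_diff_def dd_def)

lemma signed_diff_closed [simp]:
  "x \<in> carrier (grp K (Suc n)) \<Longrightarrow> signed_diff K B \<alpha> n x \<in> carrier (grp K n)"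
  by (simp add: signed_diff_def)

lemma V_keys: "c \<in> V n \<Longrightarrow> b \<in> Poly_Mapping.keys c \<Longrightarrow> b \<in> B n"
  by (auto simp: V_def)

text \<open>Additive maps into \<open>int\<close> are linear over \<open>int\<close>, by induction
  on the coefficient. It is applied to a single coefficient of the boundary and to the
  augmentation.\<close>

lemma additive_sum:
  fixes h :: "('a \<Rightarrow>\<^sub>0 int) \<Rightarrow> int"
  assumes add: "\<And>c c'. c \<in> V n \<Longrightarrow> c' \<in> V n \<Longrightarrow> h (c + c') = h c + h c'"
    and S: "finite S" "S \<subseteq> B n"
  shows "h (\<Sum>b\<in>S. Poly_Mapping.single b (g b)) = (\<Sum>b\<in>S. g b * h (Poly_Mapping.single b 1))"
proof -
  have zero: "h 0 = 0"
    using add[of 0 0] by simp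
  have single: "h (Poly_Mapping.single b m) = m * h (Poly_Mapping.single b 1)" if "b \<in> B n" for b m
  proof (induction m rule: int_induct[where k = 0])
    case base
    then show ?case using zero by simp
  next
    case (step1 i)
    then show ?case
      using add[of "Poly_Mapping.single b i" "Poly_Mapping.single b 1"] that
      by (simp add: single_add algebra_simps)
  next
    case (step2 i)
    then show ?case
      using add[of "Poly_Mapping.single b (i - 1)" "Poly_Mapping.single b 1"] that
      by (simp add: single_add[symmetric] algebra_simps)
  qed
  show ?thesis
    using S
  proof (induction S rule: finite_induct)
    case empty
    then show ?case using zero by simp
  next
    case (insert b S)
    then show ?case
      using add[of "Poly_Mapping.single b (g b)" "\<Sum>b\<in>S. Poly_Mapping.single b (g b)"]
        single[of b "g b"]
      by (simp add: subset_eq)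
  qed
qed

lemma lookup_dd_sum:
  assumes "finite S" "S \<subseteq> B (Suc n)"
  shows "lk (dd n (\<Sum>b\<in>S. Poly_Mapping.single b (g b))) t =
    (\<Sum>b\<in>S. g b * lk (dd n (Poly_Mapping.single b 1)) t)"
  by (rule additive_sum[where h = "\<lambda>c. lk (dd n c) t"]) (use assms in \<open>auto simp: dd_add lookup_add\<close>)

lemma lookup_dd:
  assumes "c \<in> V (Suc n)"
  shows "lk (dd n c) t = (\<Sum>b\<in>Poly_Mapping.keys c. lk c b * lk (dd n (Poly_Mapping.single b 1)) t)"
  using lookup_dd_sum[of "Poly_Mapping.keys c" n "lk c" t] assms
  by (simp add: sum_monomials V_def)

text \<open>The coordinate form of \<open>nu_cells\<close>, with no condition at indices above
  \<open>n\<close>; faces, cuts and composites may take arbitrary values there, which keeps their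
  formulas short.\<close>

definition is_cell :: "nat \<Rightarrow> (nat \<Rightarrow> sign \<Rightarrow> ('a \<Rightarrow>\<^sub>0 int)) \<Rightarrow> bool" where
  "is_cell n X \<longleftrightarrow> (\<forall>k\<le>n. \<forall>\<alpha>. X k \<alpha> \<in> V k \<and> nonneg (X k \<alpha>)) \<and> X n Minus = X n Plus \<and>
     (\<forall>k<n. \<forall>\<alpha>. dd k (X (Suc k) \<alpha>) = X k Plus - X k Minus) \<and> (\<forall>\<alpha>. ee (X 0 \<alpha>) = 1)"

lemma is_cell_V: "is_cell n X \<Longrightarrow> k \<le> n \<Longrightarrow> X k \<alpha> \<in> V k"
  and is_cell_nonneg: "is_cell n X \<Longrightarrow> k \<le> n \<Longrightarrow> 0 \<le> lk (X k \<alpha>) b"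
  and is_cell_top: "is_cell n X \<Longrightarrow> X n Minus = X n Plus"
  and is_cell_dd: "is_cell n X \<Longrightarrow> k < n \<Longrightarrow> dd k (X (Suc k) \<alpha>) = X k Plus - X k Minus"
  and is_cell_ee: "is_cell n X \<Longrightarrow> ee (X 0 \<alpha>) = 1"
  by (auto simp: is_cell_def nonneg_def)

lemma is_cell_bnd:
  "is_cell n X \<Longrightarrow> k \<le> n \<Longrightarrow> is_cell k (\<lambda>i \<beta>. if i < k then X i \<beta> else X i \<alpha>)"
  unfolding is_cell_def by auto

section \<open>Cuts and composites of cells\<close>

definition restr :: "('a \<Rightarrow>\<^sub>0 int) \<Rightarrow> 'a set \<Rightarrow> ('a \<Rightarrow>\<^sub>0 int)" where
  "restr c D = (\<Sum>b\<in>D. Poly_Mapping.single b (lk c b))"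

text \<open>Only nonnegativity in degree \<open>r\<close> needs an idea. If no element of
  \<open>D\<close> consumes \<open>t\<close>, its coefficient can only grow from the source. If some
  element of \<open>D\<close> does, closedness says that nothing outside \<open>D\<close> produces
  \<open>t\<close>; applying the rest can only lower the coefficient, and it ends at that of the
  target, which is nonnegative. In the formula, the second branch matters for \<open>k = r\<close>
  only.\<close>

lemma is_cell_cut:
  assumes X: "is_cell (Suc r) X" and D: "D \<subseteq> Poly_Mapping.keys (X (Suc r) Plus)"
    and closed: "\<And>i j t. \<lbrakk>i \<in> D; j \<in> Poly_Mapping.keys (X (Suc r) Plus); j \<notin> D;
      lk (dd r (Poly_Mapping.single i 1)) t < 0\<rbrakk> \<Longrightarrow> lk (dd r (Poly_Mapping.single j 1)) t \<le> 0"
  shows "is_cell r (\<lambda>k \<alpha>. if k < r then X k \<alpha> else X k Minus + dd k (restr (X (Suc k) Plus) D))"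
proof -
  let ?c = "X (Suc r) Plus"
  let ?m = "\<lambda>b t. lk (dd r (Poly_Mapping.single b 1)) t"
  have cV: "?c \<in> V (Suc r)" and c0: "0 \<le> lk ?c b" for b
    using X by (auto intro: is_cell_V is_cell_nonneg)
  have fin: "finite D"
    using D finite_keys finite_subset by blast
  have DB: "D \<subseteq> B (Suc r)"
    using D cV V_keys by blast
  have rV: "restr ?c D \<in> V (Suc r)"
    unfolding restr_def using DB by (intro V_sum V_single) auto
  have "0 \<le> lk (X r Minus + dd r (restr ?c D)) t" for t
  proof (cases "\<exists>i\<in>D. ?m i t < 0")
    case True
    then have le: "?m j t \<le> 0" if "j \<in> Poly_Mapping.keys ?c - D" for j
      using closed that by blast
    have "(\<Sum>b\<in>Poly_Mapping.keys ?c. lk ?c b * ?m b t) =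
        (\<Sum>b\<in>D. lk ?c b * ?m b t) + (\<Sum>b\<in>Poly_Mapping.keys ?c - D. lk ?c b * ?m b t)"
      using D by (simp add: sum.subset_diff add.commute)
    moreover have "(\<Sum>b\<in>Poly_Mapping.keys ?c - D. lk ?c b * ?m b t) \<le> 0"
      by (rule sum_nonpos) (use le c0 in \<open>auto intro: mult_nonneg_nonpos\<close>)
    ultimately have "lk (dd r ?c) t \<le> lk (dd r (restr ?c D)) t"
      by (simp add: lookup_dd[OF cV] restr_def lookup_dd_sum[OF fin DB])
    moreover have "lk (dd r ?c) t = lk (X r Plus) t - lk (X r Minus) t"
      using is_cell_dd[OF X, of r Plus] by (simp add: lookup_minus)
    moreover have "0 \<le> lk (X r Plus) t"
      using is_cell_nonneg[OF X] by simp
    ultimately show ?thesis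
      by (simp add: lookup_add)
  next
    case False
    then have "0 \<le> (\<Sum>b\<in>D. lk ?c b * ?m b t)"
      using c0 by (intro sum_nonneg mult_nonneg_nonneg) (auto simp: not_less)
    then show ?thesis
      using is_cell_nonneg[OF X, of r Minus t]
      by (simp add: restr_def lookup_dd_sum[OF fin DB] lookup_add)
  qed
  then have nn: "nonneg (X r Minus + dd r (restr ?c D))"
    by (simp add: nonneg_def)
  \<comment> \<open>The cut differs from the source by a boundary, which changes neither its own
    boundary nor, in degree 0, its augmentation.\<close>
  have ddr: "dd k (X r Minus + dd r (restr ?c D)) = X k Plus - X k Minus" if "r = Suc k" for k
    using that is_cell_dd[OF X, of k Minus] is_cell_V[OF X, of r Minus] rV
    by (simp add: dd_add dd_dd)
  have "ee (X 0 Minus + dd 0 (restr ?c D)) = 1" if "r = 0"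
    using that is_cell_ee[OF X, of Minus] is_cell_V[OF X, of r Minus] rV
    by (simp add: ee_add ee_dd)
  then show ?thesis
    using X nn ddr rV unfolding is_cell_def by (auto simp: less_Suc_eq_le)
qed

text \<open>The entries add above \<open>k\<close>; in degree \<open>k\<close> the sum of the two
  boundaries telescopes through the common entry.\<close>

lemma is_cell_comp:
  assumes X: "is_cell n X" and Y: "is_cell n Y" and k: "k < n"
    and eq: "\<And>i \<beta>. i < k \<Longrightarrow> X i \<beta> = Y i \<beta>" "X k Minus = Y k Plus"
  shows "is_cell n (\<lambda>i \<beta>. if i < k then X i \<beta>
    else if i = k then (if \<beta> = Plus then X k Plus else Y k Minus) else X i \<beta> + Y i \<beta>)"
    (is "is_cell n ?W")
proof -
  have "?W i \<beta> \<in> V i \<and> nonneg (?W i \<beta>)" if "i \<le> n" for i \<beta>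
    using X Y that unfolding is_cell_def by (auto simp: nonneg_def lookup_add)
  moreover have "dd i (?W (Suc i) \<beta>) = ?W i Plus - ?W i Minus" if i: "i < n" for i \<beta>
  proof -
    consider "Suc i < k" | "Suc i = k" | "i = k" | "k < i"
      by linarith
    then show ?thesis
    proof cases
      case 1
      then show ?thesis using is_cell_dd[OF X, of i] i by simp
    next
      case 2
      then show ?thesis using is_cell_dd[OF X, of i] is_cell_dd[OF Y, of i] i eq by auto
    next
      case 3
      have "X (Suc k) \<beta> \<in> V (Suc k)" "Y (Suc k) \<beta> \<in> V (Suc k)"
        using is_cell_V X Y k by auto
      then show ?thesis
        using is_cell_dd[OF X k] is_cell_dd[OF Y k] 3 eq(2) by (simp add: dd_add)
    next
      case 4
      have "X (Suc i) \<beta> \<in> V (Suc i)" "Y (Suc i) \<beta> \<in> V (Suc i)"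
        using is_cell_V X Y i by auto
      then show ?thesis
        using is_cell_dd[OF X i] is_cell_dd[OF Y i] 4 by (simp add: dd_add)
    qed
  qed
  moreover have "?W n Minus = ?W n Plus"
    using is_cell_top[OF X] is_cell_top[OF Y] k by simp
  moreover have "ee (?W 0 \<beta>) = 1" for \<beta>
    using is_cell_ee[OF X] is_cell_ee[OF Y] by auto
  ultimately show ?thesis
    unfolding is_cell_def by blast
qed

end

section \<open>Consequences of unitarity and loop-freeness\<close>

locale ulf_complex = adc_with_basis +
  assumes unitary: "unitary K B" and loop_free: "loop_free K B"
begin

lemma bracket_pred: "bracket K B \<alpha> (Suc r) b r = signed_diff K B \<alpha> r b"
  by (simp add: bracket.simps[of K B \<alpha> "Suc r" b r] bracket.simps[of K B \<alpha> "Suc r" b "Suc r"])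

text \<open>Cuts of \<open>Suc r\<close>-cells compare only elements of degree \<open>Suc r\<close>.
  For these a bracket is a single boundary step, so the generating relation can be read off the
  signs of the boundary coefficients.\<close>

lemma odot_gen_iff:
  assumes "i \<in> B (Suc r)" "j \<in> B (Suc r)"
  shows "((Suc r, i), (Suc r, j)) \<in> odot_gen K B r \<longleftrightarrow>
    (\<exists>t. lk (dd r (Poly_Mapping.single i 1)) t < 0 \<and> 0 < lk (dd r (Poly_Mapping.single j 1)) t)"
proof -
  have "i \<in> carrier (grp K (Suc r))" "j \<in> carrier (grp K (Suc r))"
    using assms basis_carrier by auto
  then show ?thesis
    using assms
    by (auto simp: odot_gen_def bracket_pred co_signed_diff coeff_min_eq_0_iff min_def max_def
        not_le split: if_splits)
qed

lemma odot_refl: "i \<in> B p \<Longrightarrow> ((p, i), (p, i)) \<in> odot K B r"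
  by (simp add: odot_def)

text \<open>\<open>(x, y) \<in> odot K B r\<close> means that the source of \<open>x\<close> meets the target of \<open>y\<close>, so in a
  composite \<open>y\<close> comes before \<open>x\<close>, and the cuts below are made along up-sets of \<open>odot\<close>.\<close>

lemma odot_step:
  assumes "(x, (Suc r, i)) \<in> odot K B r" "i \<in> B (Suc r)" "j \<in> B (Suc r)"
    "lk (dd r (Poly_Mapping.single i 1)) t < 0" "0 < lk (dd r (Poly_Mapping.single j 1)) t"
  shows "(x, (Suc r, j)) \<in> odot K B r"
proof -
  have "((Suc r, i), (Suc r, j)) \<in> odot_gen K B r"
    using assms odot_gen_iff by blast
  then show ?thesis
    using assms(1,3) by (auto simp: odot_def intro: rtrancl_into_rtrancl)
qed

lemma odot_antisym: "(x, y) \<in> odot K B r \<Longrightarrow> (y, x) \<in> odot K B r \<Longrightarrow> x = y"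
  using loop_free unfolding loop_free_def partial_order_on_def antisym_def by blast

text \<open>If the source vanished, so would all iterated sources below it, and the augmentation of
  the last one would be 0 instead of the 1 demanded by unitarity.\<close>

lemma source_nonzero:
  assumes b: "b \<in> B (Suc r)"
  obtains t where "lk (dd r (Poly_Mapping.single b 1)) t < 0"
proof -
  have bc: "b \<in> carrier (grp K (Suc r))"
    using b basis_carrier by auto
  have "signed_part Minus (dd r (Poly_Mapping.single b 1)) \<noteq> 0"
  proof
    assume "signed_part Minus (dd r (Poly_Mapping.single b 1)) = 0"
    then have "co r (signed_diff K B Minus r b) = 0"
      using b bc by (simp add: co_signed_diff)
    then have one: "bracket K B Minus (Suc r) b r = \<one>\<^bsub>grp K r\<^esub>"
      using lin_co[of "signed_diff K B Minus r b" r] bc by (simp add: bracket_pred)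
    have sd: "signed_diff K B Minus k \<one>\<^bsub>grp K (Suc k)\<^esub> = \<one>\<^bsub>grp K k\<^esub>" for k
      using dd_zero[of k] by (simp add: signed_diff_def dd_def)
    have "bracket K B Minus (Suc r) b k = \<one>\<^bsub>grp K k\<^esub>" if "k \<le> r" for k
      using that
    proof (induction rule: inc_induct)
      case base
      then show ?case by (rule one)
    next
      case (step k)
      then show ?case
        using sd[of k] by (simp add: bracket.simps[of K B Minus "Suc r" b k])
    qed
    then have "bracket K B Minus (Suc r) b 0 = \<one>\<^bsub>grp K 0\<^esub>"
      by simp
    moreover have "aug K (bracket K B Minus (Suc r) b 0) = 1"
      using unitary b unfolding unitary_def by blast
    ultimately show False
      using ee_zero by (simp add: ee_def)
  qed
  then obtain t where "lk (signed_part Minus (dd r (Poly_Mapping.single b 1))) t \<noteq> 0"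
    by (metis lookup_zero poly_mapping_eqI)
  then show ?thesis
    using that[of t] by (simp add: max_def split: if_splits)
qed

text \<open>Stated for the top entry alone: the induction hypothesis is applied to a cut, whose
  content is its top entry, and every other entry of a cell is the top entry of one of its
  faces.\<close>

lemma cell_coeff_le_1_Plus: "is_cell n X \<Longrightarrow> lk (X n Plus) b \<le> 1"
proof (induction n arbitrary: X b)
  case 0
  show ?case
  proof (cases "b \<in> Poly_Mapping.keys (X 0 Plus)")
    case True
    have XV: "X 0 Plus \<in> V 0"
      using 0 by (auto intro: is_cell_V)
    \<comment> \<open>In degree 0 unitarity says that basis elements have augmentation 1, so the
      nonnegative coefficients of a 0-cell sum to 1.\<close>
    have ee1: "ee (Poly_Mapping.single i 1) = 1" if "i \<in> B 0" for i
      using unitary that unfolding unitary_def ee_def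
      by (metis bracket.simps lin_single order_refl)
    have "1 = ee (\<Sum>i\<in>Poly_Mapping.keys (X 0 Plus). Poly_Mapping.single i (lk (X 0 Plus) i))"
      using is_cell_ee[OF 0] by (simp add: sum_monomials)
    also have "\<dots> = (\<Sum>i\<in>Poly_Mapping.keys (X 0 Plus). lk (X 0 Plus) i * ee (Poly_Mapping.single i 1))"
      by (rule additive_sum[where n = 0]) (use XV V_keys in \<open>auto simp: ee_add\<close>)
    also have "\<dots> = (\<Sum>i\<in>Poly_Mapping.keys (X 0 Plus). lk (X 0 Plus) i)"
      by (rule sum.cong) (use V_keys[OF XV] ee1 in auto)
    also have "\<dots> \<ge> lk (X 0 Plus) b"
      by (rule member_le_sum) (use True is_cell_nonneg[OF 0] in auto)
    finally show ?thesis .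
  qed (simp add: in_keys_iff)
next
  case (Suc r)
  let ?c = "X (Suc r) Plus"
  let ?m = "\<lambda>b t. lk (dd r (Poly_Mapping.single b 1)) t"
  show ?case
  proof (cases "b \<in> Poly_Mapping.keys ?c")
    case True
    have cV: "?c \<in> V (Suc r)"
      using Suc.prems by (auto intro: is_cell_V)
    note inB = V_keys[OF cV]
    \<comment> \<open>\<open>D\<close> consists of \<open>b\<close> and everything forced to precede
      it; hence \<open>D\<close> and \<open>D - {b}\<close> are the cuts just after and just before
      \<open>b\<close>.\<close>
    define D where "D = {i \<in> Poly_Mapping.keys ?c. ((Suc r, b), (Suc r, i)) \<in> odot K B r}"
    have bD: "b \<in> D"
      using True inB odot_refl by (auto simp: D_def)
    have closed: "j \<in> D"
      if "i \<in> D" "j \<in> Poly_Mapping.keys ?c" "?m i t < 0" "0 < ?m j t" for i j t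
      using that odot_step[of "(Suc r, b)" r i j t] inB by (auto simp: D_def)
    \<comment> \<open>Removing \<open>b\<close> keeps the set closed: if some other \<open>i\<close>
      in \<open>D\<close> consumed what \<open>b\<close> produces, then \<open>i\<close> and
      \<open>b\<close> would each precede the other.\<close>
    have closed': "j \<in> D - {b}"
      if ij: "i \<in> D - {b}" "j \<in> Poly_Mapping.keys ?c" "?m i t < 0" "0 < ?m j t" for i j t
    proof -
      have "j \<noteq> b"
      proof
        assume "j = b"
        then have "((Suc r, i), (Suc r, b)) \<in> odot K B r"
          using ij inB odot_step[OF odot_refl, of i r b t] by (auto simp: D_def)
        then show False
          using ij(1) odot_antisym by (force simp: D_def)
      qed
      then show ?thesis
        using closed ij by blast
    qed
    have D: "D \<subseteq> Poly_Mapping.keys ?c" "finite D"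
      by (auto simp: D_def)
    have "is_cell r (\<lambda>k \<alpha>. if k < r then X k \<alpha> else X k Minus + dd k (restr (X (Suc k) Plus) D))"
      using D closed by (intro is_cell_cut[OF Suc.prems]) (auto simp: not_less[symmetric])
    from is_cell_nonneg[OF this, of r] have ge: "0 \<le> lk (X r Minus + dd r (restr ?c D)) t" for t
      by simp
    have "is_cell r (\<lambda>k \<alpha>. if k < r then X k \<alpha> else X k Minus + dd k (restr (X (Suc k) Plus) (D - {b})))"
    proof (rule is_cell_cut[OF Suc.prems])
      show "D - {b} \<subseteq> Poly_Mapping.keys ?c"
        using D by blast
      show "?m j t \<le> 0"
        if "i \<in> D - {b}" "j \<in> Poly_Mapping.keys ?c" "j \<notin> D - {b}" "?m i t < 0" for i j t
        using closed'[of i j t] that by (meson not_le)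
    qed
    \<comment> \<open>The two cuts are used asymmetrically: the one before \<open>b\<close> is
      bounded by 1 through induction, and the one after \<open>b\<close> only contributes that it is
      nonnegative.\<close>
    from Suc.IH[OF this] have le: "lk (X r Minus + dd r (restr ?c (D - {b}))) t \<le> 1" for t
      by simp
    obtain t where t: "?m b t < 0"
      using source_nonzero inB[OF True] by blast
    have "lk (dd r (restr ?c D)) t = lk ?c b * ?m b t + lk (dd r (restr ?c (D - {b}))) t"
    proof -
      have "D \<subseteq> B (Suc r)" "D - {b} \<subseteq> B (Suc r)"
        using D inB by auto
      with D bD show ?thesis
        unfolding restr_def by (subst (1 2) lookup_dd_sum) (auto intro: sum.remove)
    qed
    then have "- (lk ?c b * ?m b t) \<le> 1"
      using ge[of t] le[of t] by (simp add: lookup_add)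
    \<comment> \<open>A negative integer is at most -1, so each copy of \<open>b\<close> consumes at
      least one \<open>t\<close>.\<close>
    moreover have "lk ?c b * 1 \<le> lk ?c b * (- ?m b t)"
      using t is_cell_nonneg[OF Suc.prems, of "Suc r" Plus b] by (intro mult_left_mono) auto
    ultimately show ?thesis
      by simp
  qed (simp add: in_keys_iff)
qed

theorem cell_coeff_le_1:
  assumes "is_cell n X" "k \<le> n"
  shows "lk (X k \<alpha>) b \<le> 1"
  using cell_coeff_le_1_Plus[OF is_cell_bnd[OF assms, of \<alpha>]] by simp

text \<open>Composability along \<open>k\<close> sees only entries of degree at most
  \<open>k\<close>, so an \<open>i\<close>-face of \<open>X\<close> and an \<open>i\<close>-face of
  \<open>Y\<close> of any two signs can be composed. Their top entries add up to a top entry, which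
  is bounded by 1. The independence of the signs is what \<open>phi_comp\<close> needs.\<close>

lemma cells_disjoint_above:
  assumes X: "is_cell n X" and Y: "is_cell n Y" and k: "k < i" "i \<le> n"
    and eq: "\<And>i \<beta>. i < k \<Longrightarrow> X i \<beta> = Y i \<beta>" "X k Minus = Y k Plus"
  shows "lk (X i \<alpha>) b = 0 \<or> lk (Y i \<beta>) b = 0"
proof -
  let ?X = "\<lambda>j \<gamma>. if j < i then X j \<gamma> else X j \<alpha>"
  let ?Y = "\<lambda>j \<gamma>. if j < i then Y j \<gamma> else Y j \<beta>"
  have "is_cell i ?X" "is_cell i ?Y"
    using is_cell_bnd X Y k by auto
  from is_cell_comp[OF this k(1)] have "lk (X i \<alpha> + Y i \<beta>) b \<le> 1"
    using eq k(1) by (auto dest!: cell_coeff_le_1_Plus[where b = b])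
  moreover have "0 \<le> lk (X i \<alpha>) b" "0 \<le> lk (Y i \<beta>) b"
    using is_cell_nonneg X Y k by auto
  ultimately show ?thesis
    unfolding lookup_add by linarith
qed

text \<open>Otherwise \<open>b\<close> lies in the source of the composite, disappears at the common
  boundary and is produced again by some \<open>a\<close> in \<open>X\<close>. A consumer of
  \<open>b\<close> has to come after the producer \<open>a\<close>, so the cut just after
  \<open>a\<close> still contains the original \<open>b\<close> together with a new one, against the
  bound by 1.\<close>

lemma no_return:
  assumes X: "is_cell n X" and Y: "is_cell n Y" and k: "k < n"
    and eq: "\<And>i \<beta>. i < k \<Longrightarrow> X i \<beta> = Y i \<beta>" "X k Minus = Y k Plus"
    and b: "0 < lk (Y k Minus) b" "0 < lk (X k Plus) b"
  shows "lk (X k Minus) b \<noteq> 0"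
proof
  assume q: "lk (X k Minus) b = 0"
  let ?m = "\<lambda>i. lk (dd k (Poly_Mapping.single i 1)) b"
  \<comment> \<open>Passing to the targets of dimension \<open>Suc k\<close> makes the composite a
    cell that can be cut in degree \<open>k\<close>.\<close>
  let ?X = "\<lambda>j \<gamma>. if j < Suc k then X j \<gamma> else X j Plus"
  let ?Y = "\<lambda>j \<gamma>. if j < Suc k then Y j \<gamma> else Y j Plus"
  let ?W = "\<lambda>i \<beta>. if i < k then ?X i \<beta>
    else if i = k then (if \<beta> = Plus then ?X k Plus else ?Y k Minus) else ?X i \<beta> + ?Y i \<beta>"
  have XY: "is_cell (Suc k) ?X" "is_cell (Suc k) ?Y"
    using is_cell_bnd[OF X, of "Suc k" Plus] is_cell_bnd[OF Y, of "Suc k" Plus] k by auto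
  have W: "is_cell (Suc k) ?W"
    by (rule is_cell_comp[OF XY]) (use eq in auto)
  define c where "c = X (Suc k) Plus + Y (Suc k) Plus"
  have cV: "X (Suc k) Plus \<in> V (Suc k)" "c \<in> V (Suc k)"
    using is_cell_V X Y k by (auto simp: c_def)
  have nn: "0 \<le> lk (X (Suc k) Plus) i" "0 \<le> lk (Y (Suc k) Plus) i" for i
    using is_cell_nonneg X Y k by auto
  have "0 < lk (dd k (X (Suc k) Plus)) b"
    using is_cell_dd[OF X k] b(2) q by (simp add: lookup_minus)
  \<comment> \<open>The coefficient of \<open>b\<close> grows along \<open>X\<close>, so some
    summand of its boundary is positive there.\<close>
  then have "\<exists>a\<in>Poly_Mapping.keys (X (Suc k) Plus). 0 < ?m a"
    unfolding lookup_dd[OF cV(1)]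
    by (metis (no_types, lifting) nn(1) mult_nonneg_nonpos not_less sum_nonpos)
  then obtain a where a: "0 < lk (X (Suc k) Plus) a" "a \<in> B (Suc k)" "0 < ?m a"
    using V_keys[OF cV(1)] nn(1) by (metis in_keys_iff order_le_less)
  have ac: "0 < lk c a"
    using a nn(2)[of a] by (simp add: c_def lookup_add)
  define D where "D = {i \<in> Poly_Mapping.keys c. ((Suc k, a), (Suc k, i)) \<in> odot K B k}"
  have aD: "a \<in> D"
    using ac a odot_refl by (auto simp: D_def in_keys_iff)
  have D: "D \<subseteq> Poly_Mapping.keys c" "finite D" "D \<subseteq> B (Suc k)"
    using V_keys[OF cV(2)] by (auto simp: D_def)
  have "is_cell k (\<lambda>i \<beta>. if i < k then ?W i \<beta> else ?W i Minus + dd i (restr (?W (Suc i) Plus) D))"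
  proof (rule is_cell_cut[OF W])
    fix i j t
    assume "i \<in> D" "j \<in> Poly_Mapping.keys (?W (Suc k) Plus)" "j \<notin> D"
      "lk (dd k (Poly_Mapping.single i 1)) t < 0"
    then show "lk (dd k (Poly_Mapping.single j 1)) t \<le> 0"
      using odot_step[of "(Suc k, a)" k i j t] V_keys[OF cV(2)]
      by (force simp: D_def c_def[symmetric] not_less[symmetric])
  qed (use D in \<open>simp add: c_def\<close>)
  from cell_coeff_le_1_Plus[OF this, of b] have le: "lk (Y k Minus) b + lk (dd k (restr c D)) b \<le> 1"
    by (simp add: lookup_add c_def)
  \<comment> \<open>An element of \<open>D\<close> consuming \<open>b\<close> would be related to
    \<open>a\<close> in both directions and so equal \<open>a\<close>, which produces
    \<open>b\<close>.\<close>
  have "0 \<le> ?m i" if "i \<in> D" for i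
  proof (rule ccontr)
    assume "\<not> 0 \<le> ?m i"
    then have "((Suc k, i), (Suc k, a)) \<in> odot K B k"
      using that a(2,3) D(3) odot_step[OF odot_refl, of i k a b] by auto
    then show False
      using that a(3) odot_antisym[of "(Suc k, a)" "(Suc k, i)" k] \<open>\<not> 0 \<le> ?m i\<close>
      by (auto simp: D_def)
  qed
  moreover have "0 \<le> lk c i" for i
    using nn[of i] by (simp add: c_def lookup_add)
  ultimately have "lk c a * ?m a \<le> (\<Sum>i\<in>D. lk c i * ?m i)"
    using aD D(2) by (intro member_le_sum) auto
  then have "lk c a * ?m a \<le> lk (dd k (restr c D)) b"
    by (simp add: restr_def lookup_dd_sum[OF D(2,3)])
  moreover have "0 < lk c a * ?m a"
    using ac a(3) by simp
  ultimately show False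
    using le b(1) by linarith
qed

end

section \<open>Categories of globular sets and omega-categories\<close>

lemma not_Plus_iff: "\<alpha> \<noteq> Plus \<longleftrightarrow> \<alpha> = Minus"
  by (cases \<alpha>) auto

lemma globular_map_id: "globular_set X \<Longrightarrow> globular_map X X (cells_id X)"
  by unfold_locales (auto simp: cells_id_def globular_set.bnd_closed)

lemma globular_map_mem: "globular_map X Y F \<Longrightarrow> x \<in> cells X n \<Longrightarrow> F n x \<in> cells Y n"
  using globular_map.maps_cells PiE_mem by metis

lemma cells_compose_apply: "x \<in> cells X n \<Longrightarrow> cells_compose X G F n x = G n (F n x)"
  by (simp add: cells_compose_def compose_eq)

lemma globular_map_compose:
  assumes X: "globular_set X" and F: "globular_map X Y F" and G: "globular_map Y Z G"
  shows "globular_map X Z (cells_compose X G F)"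
proof
  show "cells_compose X G F n \<in> cells X n \<rightarrow>\<^sub>E cells Z n" for n
    using globular_map_mem[OF F] globular_map_mem[OF G]
    by (auto simp: cells_compose_def compose_def)
next
  fix k n x \<alpha> assume *: "k < n" "x \<in> cells X n"
  show "cells_compose X G F k (bnd X n k \<alpha> x) = bnd Z n k \<alpha> (cells_compose X G F n x)"
    using * globular_set.bnd_closed[OF X *] globular_map_mem[OF F *(2)]
    by (simp add: cells_compose_apply globular_map.map_bnd[OF F] globular_map.map_bnd[OF G])
qed

lemma globular_map_extensional: "globular_map X Y F \<Longrightarrow> F n \<in> extensional (cells X n)"
  using globular_map.maps_cells PiE_iff by metis

text \<open>An equality of functions, and not merely agreement on cells, because globular maps are
  extensional in each dimension.\<close>

lemma cells_compose_id_left: "globular_map X Y F \<Longrightarrow> cells_compose X (cells_id Y) F = F"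
  by (intro ext)
     (auto simp: cells_compose_def compose_def cells_id_def globular_map_mem restrict_def
        extensional_arb[OF globular_map_extensional])

lemma cells_compose_id_right: "globular_map X Y F \<Longrightarrow> cells_compose X F (cells_id X) = F"
  by (intro ext)
     (auto simp: cells_compose_def compose_def cells_id_def globular_map_mem restrict_def
        extensional_arb[OF globular_map_extensional])

lemma cells_compose_assoc:
  "globular_map W X F \<Longrightarrow>
    cells_compose W (cells_compose X H G) F = cells_compose W H (cells_compose W G F)"
  by (intro ext) (auto simp: cells_compose_def compose_def globular_map_mem restrict_def)

lemma composable_map:
  "globular_map X Y F \<Longrightarrow> composable X n k x y \<Longrightarrow> composable Y n k (F n x) (F n y)"
  unfolding composable_def by (metis globular_map.map_bnd globular_map_mem)

lemma omega_functor_id: "omega_category X \<Longrightarrow> omega_functor X X (cells_id X)"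
proof -
  assume "omega_category X"
  then interpret omega_category X .
  show ?thesis
    by (intro omega_functor.intro globular_map_id globular_set_axioms, unfold_locales)
       (auto simp: cells_id_def comp_closed unit_closed composable_def)
qed

lemma omega_functor_compose:
  assumes X: "omega_category X" and F: "omega_functor X Y F" and G: "omega_functor Y Z G"
  shows "omega_functor X Z (cells_compose X G F)"
proof -
  interpret X: omega_category X by (rule X)
  interpret F: omega_functor X Y F by (rule F)
  interpret G: omega_functor Y Z G by (rule G)
  note F' = F.globular_map_axioms
  show ?thesis
  proof (intro omega_functor.intro globular_map_compose X.globular_set_axioms
      F' G.globular_map_axioms, unfold_locales)
    fix n k x y assume *: "composable X n k x y"
    then have xy: "x \<in> cells X n" "y \<in> cells X n"
      by (auto simp: composable_def)
    show "cells_compose X G F n (ocomp X n k x y) =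
        ocomp Z n k (cells_compose X G F n x) (cells_compose X G F n y)"
      using X.comp_closed[OF *] xy composable_map[OF F' *]
      by (simp add: cells_compose_apply F.map_comp[OF *] G.map_comp)
  next
    fix n m x assume *: "n < m" "x \<in> cells X n"
    show "cells_compose X G F m (ounit X n m x) = ounit Z n m (cells_compose X G F n x)"
      using X.unit_closed[OF *] * globular_map_mem[OF F']
      by (simp add: cells_compose_apply F.map_unit G.map_unit)
  qed
qed

lemma is_category_Glob: "is_category Glob"
  by unfold_locales
     (auto simp: Glob_def globular_map_id globular_map_compose cells_compose_id_left
        cells_compose_id_right cells_compose_assoc)

lemma is_category_Omega_Cat: "is_category Omega_Cat"
  by unfold_locales
     (auto simp: Omega_Cat_def omega_functor_id omega_functor_compose
        intro: cells_compose_id_left cells_compose_id_right cells_compose_assoc omega_functor.axioms(1))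

text \<open>A degreewise injection that respects the operations reflects equations, and apart from
  closure every law is an equation. The boundary laws have to come first, since composability of
  iterated composites is itself an equation between boundaries.\<close>

lemma omega_category_transport:
  fixes X :: "('c, 'z) omega_data_scheme" and Y :: "('d, 'w) omega_data_scheme"
  assumes Y: "omega_category Y"
    and inj: "\<And>n. inj_on (G n) (cells X n)"
    and cells: "\<And>n x. x \<in> cells X n \<Longrightarrow> G n x \<in> cells Y n"
    and bnd_cl: "\<And>n k \<alpha> x. k < n \<Longrightarrow> x \<in> cells X n \<Longrightarrow> bnd X n k \<alpha> x \<in> cells X k"
    and bnd_eq: "\<And>n k \<alpha> x. k < n \<Longrightarrow> x \<in> cells X n \<Longrightarrow> G k (bnd X n k \<alpha> x) = bnd Y n k \<alpha> (G n x)"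
    and comp_cl: "\<And>n k x y. composable X n k x y \<Longrightarrow> ocomp X n k x y \<in> cells X n"
    and comp_eq: "\<And>n k x y. composable X n k x y \<Longrightarrow> G n (ocomp X n k x y) = ocomp Y n k (G n x) (G n y)"
    and unit_cl: "\<And>n m x. n < m \<Longrightarrow> x \<in> cells X n \<Longrightarrow> ounit X n m x \<in> cells X m"
    and unit_eq: "\<And>n m x. n < m \<Longrightarrow> x \<in> cells X n \<Longrightarrow> G m (ounit X n m x) = ounit Y n m (G n x)"
  shows "omega_category X"
proof -
  interpret Y: omega_category Y by (rule Y)
  have eqI: "x = y" if "G n x = G n y" "x \<in> cells X n" "y \<in> cells X n" for n x y
    using inj that by (auto dest: inj_onD)
  have comp_map: "composable Y n k (G n x) (G n y)" if "composable X n k x y" for n k x y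
    using that cells bnd_eq unfolding composable_def by metis
  have compD: "k < n" "x \<in> cells X n" "y \<in> cells X n" "bnd X n k Minus x = bnd X n k Plus y"
    if "composable X n k x y" for n k x y
    using that by (auto simp: composable_def)
  note cl = cells bnd_cl comp_cl unit_cl
  note eqs = bnd_eq comp_eq unit_eq
  have below: "bnd X n j \<alpha> (ocomp X n k x y) = bnd X n j \<alpha> x" if c: "composable X n k x y" "j < k"
    for n j k x y \<alpha>
    using compD[OF c(1)] c comp_map[OF c(1)]
    by (intro eqI[of j]) (simp_all add: cl eqs Y.bnd_comp_below)
  have source: "bnd X n k Minus (ocomp X n k x y) = bnd X n k Minus y" if c: "composable X n k x y"
    for n k x y
    using compD[OF c] c comp_map[OF c] by (intro eqI[of k]) (simp_all add: cl eqs Y.source_comp)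
  have target: "bnd X n k Plus (ocomp X n k x y) = bnd X n k Plus x" if c: "composable X n k x y"
    for n k x y
    using compD[OF c] c comp_map[OF c] by (intro eqI[of k]) (simp_all add: cl eqs Y.target_comp)
  have bb: "bnd X k j \<beta> (bnd X n k \<alpha> x) = bnd X n j \<beta> x" if "j < k" "k < n" "x \<in> cells X n"
    for j k n \<alpha> \<beta> x
    using that by (intro eqI[of j]) (simp_all add: cl eqs Y.bnd_bnd)
  have comp_bnd: "composable X j k (bnd X n j \<alpha> x) (bnd X n j \<alpha> y)"
    if c: "composable X n k x y" "k < j" "j < n" for n j k x y \<alpha>
    using compD[OF c(1)] c by (simp add: composable_def bb cl)
  have above: "bnd X n j \<alpha> (ocomp X n k x y) = ocomp X j k (bnd X n j \<alpha> x) (bnd X n j \<alpha> y)"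
    if c: "composable X n k x y" "k < j" "j < n" for n j k x y \<alpha>
    using compD[OF c(1)] c comp_map[OF c(1)] comp_bnd[OF c]
    by (intro eqI[of j]) (simp_all add: cl eqs Y.bnd_comp_above)
  have unit_below: "bnd X m j \<alpha> (ounit X n m x) = bnd X n j \<alpha> x"
    if "j < n" "n < m" "x \<in> cells X n" for j n m x \<alpha>
    using that by (intro eqI[of j]) (simp_all add: cl eqs Y.bnd_unit_below)
  have unit_same: "bnd X m n \<alpha> (ounit X n m x) = x" if "n < m" "x \<in> cells X n" for n m x \<alpha>
    using that by (intro eqI[of n]) (simp_all add: cl eqs Y.bnd_unit_same)
  show ?thesis
  proof
    fix n m j x \<alpha> assume "n < j" "j < m" "x \<in> cells X n"
    then show "bnd X m j \<alpha> (ounit X n m x) = ounit X n j x"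
      by (intro eqI[of j]) (simp_all add: cl eqs Y.bnd_unit_above)
  next
    fix k n m x assume "k < n" "n < m" "x \<in> cells X k"
    then show "ounit X n m (ounit X k n x) = ounit X k m x"
      by (intro eqI[of m]) (simp_all add: cl eqs Y.unit_unit)
  next
    fix k n x assume *: "k < n" "x \<in> cells X n"
    then have "composable X n k x (ounit X k n (bnd X n k Minus x))"
      by (simp add: composable_def cl unit_same)
    then show "ocomp X n k x (ounit X k n (bnd X n k Minus x)) = x"
      using * by (intro eqI[of n]) (simp_all add: cl eqs Y.unit_right)
  next
    fix k n x assume *: "k < n" "x \<in> cells X n"
    then have "composable X n k (ounit X k n (bnd X n k Plus x)) x"
      by (simp add: composable_def cl unit_same)
    then show "ocomp X n k (ounit X k n (bnd X n k Plus x)) x = x"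
      using * by (intro eqI[of n]) (simp_all add: cl eqs Y.unit_left)
  next
    fix n k m x y assume c: "composable X n k x y" and m: "n < m"
    then have "composable X m k (ounit X n m x) (ounit X n m y)"
      using compD[OF c] by (simp add: composable_def cl unit_below)
    then show "ounit X n m (ocomp X n k x y) = ocomp X m k (ounit X n m x) (ounit X n m y)"
      using compD[OF c] c m comp_map[OF c]
      by (intro eqI[of m]) (simp_all add: cl eqs Y.unit_comp)
  next
    fix n k x y z assume c: "composable X n k x y" "composable X n k y z"
    then have "composable X n k (ocomp X n k x y) z" "composable X n k x (ocomp X n k y z)"
      using compD[OF c(1)] compD[OF c(2)] by (simp_all add: composable_def cl source target)
    then show "ocomp X n k (ocomp X n k x y) z = ocomp X n k x (ocomp X n k y z)"
      using c comp_map[OF c(1)] comp_map[OF c(2)]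
      by (intro eqI[of n]) (simp_all add: cl eqs Y.comp_assoc)
  next
    fix j k n x y z w
    assume j: "j < k" and c: "composable X n k x y" "composable X n k z w"
      "composable X n j x z" "composable X n j y w"
    note D = compD[OF c(1)] compD[OF c(2)] compD[OF c(3)] compD[OF c(4)]
    have "composable X n j (ocomp X n k x y) (ocomp X n k z w)"
      using c D j by (simp add: composable_def cl below)
    moreover have "composable X n k (ocomp X n j x z) (ocomp X n j y w)"
      using c D j by (simp add: composable_def cl above)
    ultimately show "ocomp X n j (ocomp X n k x y) (ocomp X n k z w) =
        ocomp X n k (ocomp X n j x z) (ocomp X n j y w)"
      using c comp_map[OF c(1)] comp_map[OF c(2)] comp_map[OF c(3)] comp_map[OF c(4)]
        Y.exchange[OF j, of n "G n x" "G n y" "G n z" "G n w"]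
      by (intro eqI[of n]) (simp_all add: cl eqs)
  qed (fact bnd_cl bb comp_cl below source target above unit_cl unit_below unit_same)+
qed

text \<open>Apply \<open>F\<close>, use that it preserves the structure, and cancel. Hence of two
  mutually inverse families of maps only one has to be shown to be a functor.\<close>

lemma omega_iso_of_inverse:
  assumes X: "omega_category X" and F: "omega_functor X Y F"
    and G: "\<And>n. G n \<in> cells Y n \<rightarrow>\<^sub>E cells X n"
    and GF: "\<And>n x. x \<in> cells X n \<Longrightarrow> G n (F n x) = x"
    and FG: "\<And>n y. y \<in> cells Y n \<Longrightarrow> F n (G n y) = y"
  shows "omega_functor Y X G" "omega_iso X Y F"
proof -
  interpret X: omega_category X by (rule X)
  interpret F: omega_functor X Y F by (rule F)
  have G': "G n y \<in> cells X n" if "y \<in> cells Y n" for n y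
    using G that PiE_mem by metis
  have bnd: "G k (bnd Y n k \<alpha> y) = bnd X n k \<alpha> (G n y)" if "k < n" "y \<in> cells Y n" for k n \<alpha> y
    using GF[OF X.bnd_closed] F.map_bnd G' FG that by metis
  have comp: "G n (ocomp Y n k x y) = ocomp X n k (G n x) (G n y)" if "composable Y n k x y" for n k x y
  proof -
    have "composable X n k (G n x) (G n y)"
      using that G' bnd unfolding composable_def by metis
    then show ?thesis
      using GF[OF X.comp_closed] F.map_comp FG that unfolding composable_def by metis
  qed
  show GYX: "omega_functor Y X G"
  proof
    show "G m (ounit Y n m y) = ounit X n m (G n y)" if "n < m" "y \<in> cells Y n" for n m y
      using GF[OF X.unit_closed] F.map_unit G' FG that by metis
  qed (use G bnd comp in auto)
  have "cells_compose X G F = cells_id X" "cells_compose Y F G = cells_id Y"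
    by (intro ext; auto simp: cells_compose_def cells_id_def compose_def restrict_def GF FG)+
  then show "omega_iso X Y F"
    using F GYX unfolding omega_iso_def by blast
qed

section \<open>The omega-category \<open>nu K\<close>\<close>

context adc_with_basis
begin

lemma grp_monoid: "Group.monoid (grp K n)"
  using is_group by (rule group.is_monoid)

lemmas grp_closed [simp] = monoid.m_closed[OF grp_monoid] monoid.one_closed[OF grp_monoid]
  group.inv_closed[OF is_group]

lemmas grp_unit [simp] = monoid.l_one[OF grp_monoid] monoid.r_one[OF grp_monoid]

lemma co_inv: "x \<in> carrier (grp K n) \<Longrightarrow> co n (inv\<^bsub>grp K n\<^esub> x) = - co n x"
  using co_mult[of x n "inv\<^bsub>grp K n\<^esub> x"] group.r_inv[OF is_group, of x n]
  by (simp add: eq_neg_iff_add_eq_0 add.commute)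

lemma is_cell_cong:
  assumes "\<And>i \<beta>. i \<le> n \<Longrightarrow> X i \<beta> = Y i \<beta>"
  shows "is_cell n X \<longleftrightarrow> is_cell n Y"
  using assms unfolding is_cell_def by (simp cong: conj_cong)

text \<open>\<open>co\<close> is injective on carriers and turns quotients into differences, so each
  clause of \<open>nu_cells\<close> becomes the corresponding clause of
  \<open>is_cell\<close>.\<close>

lemma nu_cells_iff:
  "x \<in> nu_cells K n \<longleftrightarrow> (\<forall>k\<le>n. \<forall>\<alpha>. x k \<alpha> \<in> carrier (grp K k)) \<and>
    (\<forall>k>n. \<forall>\<alpha>. x k \<alpha> = undefined) \<and> is_cell n (\<lambda>k \<alpha>. co k (x k \<alpha>))"
  (is "_ \<longleftrightarrow> ?carr \<and> ?und \<and> ?cell")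
proof (cases ?carr)
  case True
  have "diff K k (x (Suc k) \<alpha>) = x k Plus \<otimes>\<^bsub>grp K k\<^esub> inv\<^bsub>grp K k\<^esub> (x k Minus) \<longleftrightarrow>
      dd k (co (Suc k) (x (Suc k) \<alpha>)) = co k (x k Plus) - co k (x k Minus)" if "k < n" for k \<alpha>
    using True that
    by (subst co_inject[symmetric, where n = k]) (auto simp: co_mult co_inv dd_def)
  moreover have "x n Minus = x n Plus \<longleftrightarrow> co n (x n Minus) = co n (x n Plus)"
    using True by (simp add: co_inject)
  moreover have "ee (co 0 (x 0 \<alpha>)) = aug K (x 0 \<alpha>)" for \<alpha>
    using True by (simp add: ee_def)
  ultimately show ?thesis
    using True unfolding nu_cells_def is_cell_def by (auto simp: pos_iff)
next
  case False
  then show ?thesis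
    unfolding nu_cells_def by (auto simp: pos_iff)
qed

lemma nu_cells_carrier: "x \<in> nu_cells K n \<Longrightarrow> k \<le> n \<Longrightarrow> x k \<alpha> \<in> carrier (grp K k)"
  and nu_cells_undefined: "x \<in> nu_cells K n \<Longrightarrow> n < k \<Longrightarrow> x k \<alpha> = undefined"
  and nu_cells_cell: "x \<in> nu_cells K n \<Longrightarrow> is_cell n (\<lambda>k \<alpha>. co k (x k \<alpha>))"
  by (simp_all add: nu_cells_iff)

lemma nu_cells_top: "x \<in> nu_cells K n \<Longrightarrow> x n Minus = x n Plus"
  by (simp add: nu_cells_def)

lemma nu_sel [simp]: "cells (nu K) = nu_cells K" "bnd (nu K) = nu_bnd"
  "ocomp (nu K) = nu_comp K" "ounit (nu K) = nu_unit K"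
  by (simp_all add: nu_def)

lemma composable_nu_iff:
  "composable (nu K) n k x y \<longleftrightarrow> k < n \<and> x \<in> nu_cells K n \<and> y \<in> nu_cells K n \<and>
    (\<forall>i<k. \<forall>\<beta>. x i \<beta> = y i \<beta>) \<and> x k Minus = y k Plus"
proof -
  have "nu_bnd n k Minus x = nu_bnd n k Plus y \<longleftrightarrow>
      (\<forall>i<k. \<forall>\<beta>. x i \<beta> = y i \<beta>) \<and> x k Minus = y k Plus" (is "?L \<longleftrightarrow> ?R")
  proof
    assume ?L
    then have "nu_bnd n k Minus x i \<beta> = nu_bnd n k Plus y i \<beta>" for i \<beta>
      by simp
    then show ?R
      unfolding nu_bnd_def by (metis less_irrefl)
  qed (auto simp: nu_bnd_def fun_eq_iff)
  then show ?thesis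
    by (auto simp: composable_def nu_def)
qed

text \<open>The subtracted cell equals both factors below \<open>k\<close>, cancels one of them at
  \<open>k\<close>, and is the unit above \<open>k\<close>. Without inverses in the formula, the
  laws can be checked entry by entry.\<close>

lemma nu_comp_eq:
  assumes "composable (nu K) n k x y"
  shows "nu_comp K n k x y = (\<lambda>i \<beta>. if i < k then x i \<beta>
    else if i = k then (if \<beta> = Plus then x k Plus else y k Minus)
    else if i \<le> n then x i \<beta> \<otimes>\<^bsub>grp K i\<^esub> y i \<beta> else undefined)" (is "_ = ?w")
proof (intro ext)
  fix i \<beta>
  have k: "k < n" and x: "x \<in> nu_cells K n" and y: "y \<in> nu_cells K n"
    and eq: "\<And>i \<beta>. i < k \<Longrightarrow> x i \<beta> = y i \<beta>" "x k Minus = y k Plus"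
    using assms by (auto simp: composable_nu_iff)
  show "nu_comp K n k x y i \<beta> = ?w i \<beta>"
  proof (cases "i \<le> n")
    case True
    interpret comm_group "grp K i" by (rule grp_comm)
    have carr: "x i \<gamma> \<in> carrier (grp K i)" "y i \<gamma> \<in> carrier (grp K i)" for \<gamma>
      using nu_cells_carrier x y True by auto
    consider "i < k" | "i = k" | "k < i"
      by linarith
    then show ?thesis
    proof cases
      case 1
      then show ?thesis
        using True carr k eq by (simp add: nu_comp_def nu_unit_def nu_bnd_def Let_def)
    next
      case 2
      have "x i Plus \<otimes>\<^bsub>grp K i\<^esub> inv\<^bsub>grp K i\<^esub> y i Plus \<otimes>\<^bsub>grp K i\<^esub> y i Plus = x i Plus"
        "y i Plus \<otimes>\<^bsub>grp K i\<^esub> inv\<^bsub>grp K i\<^esub> y i Plus \<otimes>\<^bsub>grp K i\<^esub> y i Minus = y i Minus"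
        using carr by (simp_all add: m_assoc)
      then show ?thesis
        using True carr k eq 2
        by (cases \<beta>) (simp_all add: nu_comp_def nu_unit_def nu_bnd_def Let_def)
    next
      case 3
      then show ?thesis
        using True carr k by (simp add: nu_comp_def nu_unit_def nu_bnd_def Let_def)
    qed
  next
    case False
    then show ?thesis
      using k by (simp add: nu_comp_def Let_def)
  qed
qed

lemma nu_comp_closed:
  assumes "composable (nu K) n k x y"
  shows "nu_comp K n k x y \<in> nu_cells K n"
proof -
  have k: "k < n" and x: "x \<in> nu_cells K n" and y: "y \<in> nu_cells K n"
    and eq: "\<And>i \<beta>. i < k \<Longrightarrow> x i \<beta> = y i \<beta>" "x k Minus = y k Plus"
    using assms by (auto simp: composable_nu_iff)
  have "is_cell n (\<lambda>i \<beta>. if i < k then co i (x i \<beta>)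
      else if i = k then (if \<beta> = Plus then co k (x k Plus) else co k (y k Minus))
      else co i (x i \<beta>) + co i (y i \<beta>))"
    by (rule is_cell_comp[OF nu_cells_cell[OF x] nu_cells_cell[OF y] k]) (use eq in auto)
  then have "is_cell n (\<lambda>i \<beta>. co i (nu_comp K n k x y i \<beta>))"
    by (rule is_cell_cong[THEN iffD1, rotated])
       (simp add: nu_comp_eq[OF assms] co_mult nu_cells_carrier[OF x] nu_cells_carrier[OF y])
  then show ?thesis
    using k nu_cells_carrier[OF x] nu_cells_carrier[OF y]
    by (auto simp: nu_cells_iff nu_comp_eq[OF assms])
qed

lemma nu_bnd_closed: "k < n \<Longrightarrow> x \<in> nu_cells K n \<Longrightarrow> nu_bnd n k \<alpha> x \<in> nu_cells K k"
  unfolding nu_cells_def nu_bnd_def by auto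

lemma nu_unit_closed:
  assumes "n < m" "x \<in> nu_cells K n"
  shows "nu_unit K n m x \<in> nu_cells K m"
proof -
  have "is_cell m (\<lambda>i \<beta>. co i (nu_unit K n m x i \<beta>))"
    unfolding is_cell_def
  proof (intro conjI allI impI)
    \<comment> \<open>The critical index is \<open>k = n\<close>: the added entry above it has zero
      boundary, which matches the equality of the two top entries of \<open>x\<close>.\<close>
    fix k \<alpha> assume "k < m"
    then show "dd k (co (Suc k) (nu_unit K n m x (Suc k) \<alpha>)) =
        co k (nu_unit K n m x k Plus) - co k (nu_unit K n m x k Minus)"
      using is_cell_dd[OF nu_cells_cell[OF assms(2)], of k] nu_cells_top[OF assms(2)]
      by (cases "k = n") (auto simp: nu_unit_def)
  qed (use assms is_cell_ee[OF nu_cells_cell[OF assms(2)]]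
         is_cell_nonneg[OF nu_cells_cell[OF assms(2)]] nu_cells_carrier[OF assms(2)]
       in \<open>auto simp: nu_unit_def nonneg_def\<close>)
  then show ?thesis
    using assms nu_cells_carrier[OF assms(2)] by (auto simp: nu_cells_iff nu_unit_def)
qed

text \<open>The auxiliary facts establish composability of every composite that occurs, after which
  \<open>nu_comp_eq\<close> applies to all of them. Associativity and exchange then reduce to
  associativity and commutativity in each group.\<close>

lemma omega_category_nu: "omega_category (nu K)"
proof -
  have cD: "k < n" "x \<in> nu_cells K n" "y \<in> nu_cells K n" "\<And>i \<beta>. i < k \<Longrightarrow> x i \<beta> = y i \<beta>"
    "x k Minus = y k Plus" if "composable (nu K) n k x y" for n k x y
    using that by (auto simp: composable_nu_iff)
  have cunit: "composable (nu K) n k x (nu_unit K k n (nu_bnd n k Minus x))"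
    "composable (nu K) n k (nu_unit K k n (nu_bnd n k Plus x)) x"
    if "k < n" "x \<in> nu_cells K n" for n k x
    using that by (simp_all add: composable_nu_iff nu_unit_closed nu_bnd_closed)
      (simp_all add: nu_unit_def nu_bnd_def)
  have cbnd: "composable (nu K) j k (nu_bnd n j \<alpha> x) (nu_bnd n j \<alpha> y)"
    if "composable (nu K) n k x y" "k < j" "j < n" for n j k x y \<alpha>
    using that by (simp add: composable_nu_iff nu_bnd_closed) (simp add: nu_bnd_def)
  have cuu: "composable (nu K) m k (nu_unit K n m x) (nu_unit K n m y)"
    if "composable (nu K) n k x y" "n < m" for n m k x y
    using that by (simp add: composable_nu_iff nu_unit_closed) (simp add: nu_unit_def)
  note carr = nu_cells_carrier
  show ?thesis
  proof
    fix n m k j x y z w \<alpha> \<beta>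
    show "bnd (nu K) n k \<alpha> x \<in> cells (nu K) k" if "k < n" "x \<in> cells (nu K) n"
      using that by (simp add: nu_bnd_closed)
    show "bnd (nu K) k j \<beta> (bnd (nu K) n k \<alpha> x) = bnd (nu K) n j \<beta> x" if "j < k"
      using that by (simp add: nu_bnd_def fun_eq_iff)
    show "ounit (nu K) n m x \<in> cells (nu K) m" if "n < m" "x \<in> cells (nu K) n"
      using that by (simp add: nu_unit_closed)
    show "bnd (nu K) m j \<alpha> (ounit (nu K) n m x) = bnd (nu K) n j \<alpha> x" if "j < n"
      using that by (simp add: nu_bnd_def nu_unit_def fun_eq_iff)
    show "bnd (nu K) m n \<alpha> (ounit (nu K) n m x) = x" if "n < m" "x \<in> cells (nu K) n"
      using that nu_cells_undefined[of x n] nu_cells_top[of x n]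
      by (intro ext) (cases \<alpha>; simp add: nu_bnd_def nu_unit_def; metis sign.exhaust)
    show "bnd (nu K) m j \<alpha> (ounit (nu K) n m x) = ounit (nu K) n j x" if "n < j" "j < m"
      using that by (simp add: nu_bnd_def nu_unit_def fun_eq_iff)
    show "ounit (nu K) n m (ounit (nu K) k n x) = ounit (nu K) k m x" if "k < n" "n < m"
      using that by (simp add: nu_unit_def fun_eq_iff)
    show "ocomp (nu K) n k x (ounit (nu K) k n (bnd (nu K) n k Minus x)) = x"
      if "k < n" "x \<in> cells (nu K) n"
      using that nu_cells_undefined[of x n] carr[of x n]
      by (intro ext, simp add: nu_comp_eq cunit)
         (auto simp: nu_unit_def nu_bnd_def not_Plus_iff)
    show "ocomp (nu K) n k (ounit (nu K) k n (bnd (nu K) n k Plus x)) x = x"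
      if "k < n" "x \<in> cells (nu K) n"
      using that nu_cells_undefined[of x n] carr[of x n]
      by (intro ext, simp add: nu_comp_eq cunit)
         (auto simp: nu_unit_def nu_bnd_def not_Plus_iff)
  next
    fix n k x y assume c: "composable (nu K) n k x y"
    note D = cD[OF c]
    show "ocomp (nu K) n k x y \<in> cells (nu K) n"
      using c by (simp add: nu_comp_closed)
    show "bnd (nu K) n j \<alpha> (ocomp (nu K) n k x y) = bnd (nu K) n j \<alpha> x" if "j < k" for j \<alpha>
      using that by (simp add: nu_comp_eq[OF c] nu_bnd_def fun_eq_iff)
    show "bnd (nu K) n k Minus (ocomp (nu K) n k x y) = bnd (nu K) n k Minus y"
      using D by (simp add: nu_comp_eq[OF c] nu_bnd_def fun_eq_iff)
    show "bnd (nu K) n k Plus (ocomp (nu K) n k x y) = bnd (nu K) n k Plus x"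
      using D by (simp add: nu_comp_eq[OF c] nu_bnd_def fun_eq_iff)
    show "bnd (nu K) n j \<alpha> (ocomp (nu K) n k x y) =
        ocomp (nu K) j k (bnd (nu K) n j \<alpha> x) (bnd (nu K) n j \<alpha> y)" if "k < j" "j < n" for j \<alpha>
      using that D by (simp add: nu_comp_eq[OF c] nu_comp_eq[OF cbnd[OF c that]])
        (simp add: nu_bnd_def fun_eq_iff)
    show "ounit (nu K) n m (ocomp (nu K) n k x y) =
        ocomp (nu K) m k (ounit (nu K) n m x) (ounit (nu K) n m y)" if "n < m" for m
      using that D by (simp add: nu_comp_eq[OF c] nu_comp_eq[OF cuu[OF c that]])
        (simp add: nu_unit_def fun_eq_iff)
  next
    fix n k x y z assume c: "composable (nu K) n k x y" "composable (nu K) n k y z"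
    note D = cD[OF c(1)] cD[OF c(2)]
    have c': "composable (nu K) n k (nu_comp K n k x y) z" "composable (nu K) n k x (nu_comp K n k y z)"
      using D c by (simp_all add: composable_nu_iff nu_comp_closed) (simp_all add: nu_comp_eq c)
    show "ocomp (nu K) n k (ocomp (nu K) n k x y) z = ocomp (nu K) n k x (ocomp (nu K) n k y z)"
    proof (intro ext)
      fix i \<beta>
      interpret comm_group "grp K i" by (rule grp_comm)
      show "ocomp (nu K) n k (ocomp (nu K) n k x y) z i \<beta> =
          ocomp (nu K) n k x (ocomp (nu K) n k y z) i \<beta>"
        using D carr[of x n i] carr[of y n i] carr[of z n i]
        by (simp add: nu_comp_eq[OF c'(1)] nu_comp_eq[OF c'(2)])
           (simp add: nu_comp_eq[OF c(1)] nu_comp_eq[OF c(2)] m_assoc)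
    qed
  next
    fix j k n x y z w
    assume j: "j < k" and c: "composable (nu K) n k x y" "composable (nu K) n k z w"
      "composable (nu K) n j x z" "composable (nu K) n j y w"
    note D = cD[OF c(1)] cD[OF c(2)] cD[OF c(3)] cD[OF c(4)]
    have c1: "composable (nu K) n j (nu_comp K n k x y) (nu_comp K n k z w)"
      using D c j by (simp add: composable_nu_iff nu_comp_closed) (simp add: nu_comp_eq c)
    have c2: "composable (nu K) n k (nu_comp K n j x z) (nu_comp K n j y w)"
      using D c j by (simp add: composable_nu_iff nu_comp_closed) (auto simp add: nu_comp_eq c)
    show "ocomp (nu K) n j (ocomp (nu K) n k x y) (ocomp (nu K) n k z w) =
        ocomp (nu K) n k (ocomp (nu K) n j x z) (ocomp (nu K) n j y w)"
    proof (intro ext)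
      fix i \<beta>
      interpret comm_group "grp K i" by (rule grp_comm)
      show "ocomp (nu K) n j (ocomp (nu K) n k x y) (ocomp (nu K) n k z w) i \<beta> =
          ocomp (nu K) n k (ocomp (nu K) n j x z) (ocomp (nu K) n j y w) i \<beta>"
        using D j carr[of x n i] carr[of y n i] carr[of z n i] carr[of w n i]
        by (simp add: nu_comp_eq[OF c1] nu_comp_eq[OF c2])
           (auto simp: nu_comp_eq[OF c(1)] nu_comp_eq[OF c(2)] nu_comp_eq[OF c(3)]
             nu_comp_eq[OF c(4)] m_ac)
    qed
  qed
qed

end

section \<open>Chains\<close>

lemma cdeg_le_iff: "cdeg a \<le> int n \<longleftrightarrow> (\<forall>i>n. Poly_Mapping.lookup a i = 0)"
proof (cases "a = 0")
  case False
  then have "cdeg a \<le> int n \<longleftrightarrow> (\<forall>i\<in>Poly_Mapping.keys a. i \<le> n)"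
    by (simp add: cdeg_def)
  then show ?thesis
    by (metis in_keys_iff not_le)
qed (simp add: cdeg_def)

lemma lookup_truncation:
  "Poly_Mapping.lookup (truncation k a) i = (if i \<le> k then Poly_Mapping.lookup a i else 0)"
  by (simp add: truncation_def lookup_sum lookup_single when_def)

lemma lookup_pos_fsum:
  "Poly_Mapping.lookup (pos_fsum a) i = signed_part Plus (Poly_Mapping.lookup a i)"
  by (simp add: pos_fsum_def Poly_Mapping.map.rep_eq when_def)

lemma lookup_elt_sum:
  "Poly_Mapping.lookup (elt_sum K B k x) i = (if i = k then coords K B k x else 0)"
  by (simp add: elt_sum_def lookup_single when_def)

context adc_with_basis
begin

text \<open>The coordinates of the entries of \<open>psi\<close>. This is the only new information
  in a boundary: below degree \<open>k\<close> the boundary agrees with \<open>a\<close>, and above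
  it is zero.\<close>

definition chain_part :: "sign \<Rightarrow> 'a fsum \<Rightarrow> nat \<Rightarrow> ('a \<Rightarrow>\<^sub>0 int)" where
  "chain_part \<alpha> a k = Poly_Mapping.lookup (chain_bnd K B \<alpha> k a) k"

lemma is_chain_V: "is_chain B a \<Longrightarrow> Poly_Mapping.lookup a k \<in> V k"
  and is_chain_nonneg: "is_chain B a \<Longrightarrow> nonneg (Poly_Mapping.lookup a k)"
  by (simp_all add: is_chain_def V_def)

lemma chain_bnd_trivial: "cdeg a \<le> int k \<Longrightarrow> chain_bnd K B \<alpha> k a = a"
  by (simp add: chain_bnd.simps[of K B \<alpha> k a])

lemma chain_bnd_step:
  assumes a: "is_chain B a" and k: "\<not> cdeg a \<le> int k" and V: "chain_part \<alpha> a (Suc k) \<in> V (Suc k)"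
  shows "Poly_Mapping.lookup (chain_bnd K B \<alpha> k a) i =
    (if i = k then signed_part \<alpha> (dd k (chain_part \<alpha> a (Suc k))) else 0) +
    (if i \<le> k then Poly_Mapping.lookup (chain_bnd K B \<alpha> (Suc k) a) i else 0)"
  using k V
  by (simp add: chain_bnd.simps[of K B \<alpha> k a] lookup_add lookup_elt_sum lookup_truncation
      co_signed_diff part_elt_def chain_part_def[symmetric])

text \<open>The three claims are proved together, because the recursion for degree \<open>k\<close>
  can be expressed in coordinates only once the part of degree \<open>Suc k\<close> is known to lie
  in \<open>V (Suc k)\<close>.\<close>

lemma chain_bnd_aux:
  assumes a: "is_chain B a"
  shows "chain_part \<alpha> a k \<in> V k \<and> nonneg (chain_part \<alpha> a k) \<and>
    (\<forall>i. i \<noteq> k \<longrightarrow> Poly_Mapping.lookup (chain_bnd K B \<alpha> k a) i =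
      (if i < k then Poly_Mapping.lookup a i else 0))" (is "?P k")
proof -
  \<comment> \<open>At \<open>N\<close> the recursion has stopped; the maximum covers a
    \<open>k\<close> that already exceeds the degree of the chain.\<close>
  define N where "N = max k (nat (cdeg a))"
  have base: "?P j" if "cdeg a \<le> int j" for j
    using that a by (simp add: chain_part_def chain_bnd_trivial is_chain_V is_chain_nonneg)
      (meson cdeg_le_iff linorder_neqE_nat)
  have "k \<le> N"
    by (simp add: N_def)
  then show ?thesis
  proof (induction rule: inc_induct)
    case base
    then show ?case
      by (intro \<open>\<And>j. cdeg a \<le> int j \<Longrightarrow> ?P j\<close>) (simp add: N_def)
  next
    case (step j)
    show ?case
    proof (cases "cdeg a \<le> int j")
      case True
      then show ?thesis by (rule base)
    next
      case False
      have V: "chain_part \<alpha> a (Suc j) \<in> V (Suc j)"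
        using step.IH by blast
      note eq = chain_bnd_step[OF a False V]
      have "chain_part \<alpha> a j = signed_part \<alpha> (dd j (chain_part \<alpha> a (Suc j))) + Poly_Mapping.lookup a j"
        using eq[of j] step.IH by (simp add: chain_part_def)
      then show ?thesis
        using eq step.IH V is_chain_V[OF a, of j] is_chain_nonneg[OF a, of j]
          nonneg_signed_part[of \<alpha> "dd j (chain_part \<alpha> a (Suc j))"]
        by (auto simp: nonneg_def lookup_add)
    qed
  qed
qed

lemma chain_part_V [simp]: "is_chain B a \<Longrightarrow> chain_part \<alpha> a k \<in> V k"
  and chain_part_nonneg: "is_chain B a \<Longrightarrow> nonneg (chain_part \<alpha> a k)"
  and lookup_chain_bnd: "is_chain B a \<Longrightarrow> Poly_Mapping.lookup (chain_bnd K B \<alpha> k a) i =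
    (if i < k then Poly_Mapping.lookup a i else if i = k then chain_part \<alpha> a k else 0)"
  using chain_bnd_aux[of a \<alpha> k] by (simp_all add: chain_part_def)

lemma chain_part_above:
  assumes "cdeg a \<le> int n" "n < k"
  shows "chain_part \<alpha> a k = 0"
proof -
  have "chain_bnd K B \<alpha> k a = a"
    using assms by (intro chain_bnd_trivial) simp
  then show ?thesis
    using assms by (simp add: chain_part_def cdeg_le_iff)
qed

text \<open>Both branches of \<open>chain_bnd\<close> in one equation: from the degree of
  \<open>a\<close> upwards the boundary term is zero.\<close>

lemma chain_part_rec:
  assumes a: "is_chain B a"
  shows "chain_part \<alpha> a k = Poly_Mapping.lookup a k + signed_part \<alpha> (dd k (chain_part \<alpha> a (Suc k)))"
proof (cases "cdeg a \<le> int k")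
  case True
  then show ?thesis
    using chain_part_above[OF True, of "Suc k" \<alpha>] by (simp add: chain_part_def chain_bnd_trivial)
next
  case False
  show ?thesis
    using chain_bnd_step[OF a False chain_part_V[OF a], of \<alpha> k] lookup_chain_bnd[OF a, of \<alpha> "Suc k" k]
    by (simp add: chain_part_def add.commute)
qed

text \<open>A signed part minus its opposite is the boundary itself, provided that both signs have
  the same boundary one degree up. This proviso follows by descending induction: the difference of
  the two parts is a boundary, which \<open>dd\<close> annihilates.\<close>

lemma chain_part_dd:
  assumes a: "is_chain B a"
  shows "dd k (chain_part \<alpha> a (Suc k)) = chain_part Plus a k - chain_part Minus a k"
proof -
  have par: "dd k (chain_part Plus a (Suc k)) = dd k (chain_part Minus a (Suc k))"
  proof -
    define N where "N = max k (nat (cdeg a))"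
    have "k \<le> N"
      by (simp add: N_def)
    then show ?thesis
    proof (induction rule: inc_induct)
      case base
      have "cdeg a \<le> int N"
        by (simp add: N_def)
      then show ?case
        by (simp add: chain_part_above)
    next
      case (step j)
      let ?d = "dd (Suc j) (chain_part Plus a (Suc (Suc j)))"
      have "chain_part Plus a (Suc j) - chain_part Minus a (Suc j) =
          signed_part Plus ?d - signed_part Minus ?d"
        using chain_part_rec[OF a, of Plus "Suc j"] chain_part_rec[OF a, of Minus "Suc j"] step.IH
        by simp
      then have "chain_part Plus a (Suc j) - chain_part Minus a (Suc j) = ?d"
        by (simp add: signed_part_diff)
      then have "dd j (chain_part Plus a (Suc j) - chain_part Minus a (Suc j)) = 0"
        using a by (simp add: dd_dd)
      then show ?case
        using a by (simp add: dd_minus)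
    qed
  qed
  then have "chain_part Plus a k - chain_part Minus a k = dd k (chain_part Plus a (Suc k))"
    using chain_part_rec[OF a, of Plus k] chain_part_rec[OF a, of Minus k]
      signed_part_diff[of "dd k (chain_part Plus a (Suc k))"]
    by simp
  then show ?thesis
    using par by (cases \<alpha>) simp_all
qed

lemma coherent_iff: "is_chain B a \<Longrightarrow> coherent K B a \<longleftrightarrow> (\<forall>\<alpha>. ee (chain_part \<alpha> a 0) = 1)"
  by (simp add: coherent_def part_elt_def ee_def chain_part_def)

lemma chain_part_is_cell:
  assumes "is_chain B a" "cdeg a \<le> int n" "coherent K B a"
  shows "is_cell n (\<lambda>k \<alpha>. chain_part \<alpha> a k)"
proof -
  have "chain_part \<alpha> a n = Poly_Mapping.lookup a n" for \<alpha>
    using assms(2) by (simp add: chain_part_def chain_bnd_trivial)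
  then show ?thesis
    using assms by (simp add: is_cell_def chain_part_nonneg chain_part_dd coherent_iff)
qed

text \<open>The recursion reads \<open>p = a + max (p - q) 0\<close> in each coefficient, and its
  solution is \<open>a = min p q\<close>. So a chain is determined by its source and target
  parts.\<close>

lemma lookup_chain_eq_min:
  assumes a: "is_chain B a"
  shows "lk (Poly_Mapping.lookup a k) b = min (lk (chain_part Plus a k) b) (lk (chain_part Minus a k) b)"
proof -
  have "chain_part Plus a k =
      Poly_Mapping.lookup a k + signed_part Plus (chain_part Plus a k - chain_part Minus a k)"
    using chain_part_rec[OF a, of Plus k] unfolding chain_part_dd[OF a] .
  then have "lk (chain_part Plus a k) b = lk (Poly_Mapping.lookup a k) b +
      max (lk (chain_part Plus a k) b - lk (chain_part Minus a k) b) 0"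
    by (metis lookup_add lookup_minus lookup_signed_part(1))
  then show ?thesis
    by linarith
qed

end

section \<open>The bijection between \<open>nu K\<close> and \<open>mu K\<close> and its
  compatibility with the operations\<close>

context ulf_complex
begin

lemma the_basis_eq: "the_basis K = B"
proof -
  have "unitary_loop_free_basis K B"
    using basis unitary loop_free by (simp add: unitary_loop_free_basis_def)
  then show ?thesis
    using the_basis_ulf augmented_directed_complex_axioms is_basis_unique basis
    unfolding unitary_loop_free_basis_def by metis
qed

lemma mu_cells_iff:
  "a \<in> mu_cells K n \<longleftrightarrow> is_chain B a \<and> cdeg a \<le> int n \<and> coherent K B a"
  by (simp add: mu_cells_def the_basis_eq)

lemma psi_eq: "psi K n a = (\<lambda>k \<alpha>. if k \<le> n then lin k (chain_part \<alpha> a k) else undefined)"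
  by (simp add: psi_def the_basis_eq part_elt_def chain_part_def fun_eq_iff)

lemma psi_closed:
  assumes "a \<in> mu_cells K n"
  shows "psi K n a \<in> nu_cells K n"
proof -
  have a: "is_chain B a" "cdeg a \<le> int n" "coherent K B a"
    using assms by (auto simp: mu_cells_iff)
  have "is_cell n (\<lambda>k \<alpha>. co k (psi K n a k \<alpha>))"
    by (rule is_cell_cong[THEN iffD1, OF _ chain_part_is_cell[OF a]]) (simp add: psi_eq a)
  then show ?thesis
    using a by (simp add: nu_cells_iff psi_eq)
qed

text \<open>The cell equation rewrites the subtracted term as the positive part of
  \<open>x k Plus - x k Minus\<close>, so each degree of \<open>phi\<close> depends only on the two
  entries of that degree.\<close>

lemma lookup_phi:
  assumes x: "x \<in> nu_cells K n"
  shows "Poly_Mapping.lookup (phi K n x) i = (if i < n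
    then co i (x i Plus) - signed_part Plus (co i (x i Plus) - co i (x i Minus))
    else if i = n then co n (x n Plus) else 0)"
proof -
  have "signed_part Plus (dd k (co (Suc k) (x (Suc k) Plus))) =
      signed_part Plus (co k (x k Plus) - co k (x k Minus))" if "k < n" for k
    using is_cell_dd[OF nu_cells_cell[OF x] that] by simp
  then show ?thesis
    using nu_cells_carrier[OF x]
    by (auto simp: phi_def the_basis_eq lookup_add lookup_sum lookup_minus lookup_elt_sum
        co_signed_diff if_distrib[of "\<lambda>c. c - _"] sum.If_cases cong: sum.cong if_cong)
qed

lemma lookup_lookup_phi:
  assumes x: "x \<in> nu_cells K n"
  shows "lk (Poly_Mapping.lookup (phi K n x) i) b =
    (if i \<le> n then min (lk (co i (x i Plus)) b) (lk (co i (x i Minus)) b) else 0)"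
  using nu_cells_top[OF x] by (auto simp: lookup_phi[OF x] lookup_minus)

lemma is_chain_phi:
  assumes x: "x \<in> nu_cells K n"
  shows "is_chain B (phi K n x)"
  unfolding is_chain_def
proof (intro allI conjI)
  fix k
  have "Poly_Mapping.lookup (phi K n x) k \<in> V k"
    using nu_cells_carrier[OF x] by (simp add: lookup_phi[OF x])
  then show "Poly_Mapping.keys (Poly_Mapping.lookup (phi K n x) k) \<subseteq> B k"
    by (simp add: V_def)
  show "nonneg (Poly_Mapping.lookup (phi K n x) k)"
    using is_cell_nonneg[OF nu_cells_cell[OF x]] by (simp add: nonneg_def lookup_lookup_phi[OF x])
qed

lemma cdeg_phi: "x \<in> nu_cells K n \<Longrightarrow> cdeg (phi K n x) \<le> int n"
  by (simp add: cdeg_le_iff lookup_phi)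

text \<open>Going down one degree adds back a signed part of the difference of the two entries: the
  positive part restores the target, and the negative part turns it into the source.\<close>

lemma chain_part_phi:
  assumes x: "x \<in> nu_cells K n" and k: "k \<le> n"
  shows "chain_part \<alpha> (phi K n x) k = co k (x k \<alpha>)"
  using k
proof (induction rule: inc_induct)
  case base
  show ?case
    using chain_bnd_trivial[OF cdeg_phi[OF x]] nu_cells_top[OF x]
    by (cases \<alpha>) (simp_all add: chain_part_def lookup_phi[OF x])
next
  case (step k)
  have "dd k (co (Suc k) (x (Suc k) \<alpha>)) = co k (x k Plus) - co k (x k Minus)"
    using is_cell_dd[OF nu_cells_cell[OF x]] step by simp
  moreover have "signed_part Plus (co k (x k Plus) - co k (x k Minus)) =
      co k (x k Plus) - co k (x k Minus) + signed_part Minus (co k (x k Plus) - co k (x k Minus))"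
    using signed_part_diff by (metis diff_add_cancel)
  ultimately show ?case
    using chain_part_rec[OF is_chain_phi[OF x], of \<alpha> k] step lookup_phi[OF x, of k]
    by (cases \<alpha>) simp_all
qed

lemma phi_closed: "x \<in> nu_cells K n \<Longrightarrow> phi K n x \<in> mu_cells K n"
  using is_cell_ee[OF nu_cells_cell, of x n]
  by (simp add: mu_cells_iff is_chain_phi cdeg_phi coherent_iff chain_part_phi)

lemma psi_phi:
  assumes x: "x \<in> nu_cells K n"
  shows "psi K n (phi K n x) = x"
  using nu_cells_carrier[OF x] nu_cells_undefined[OF x]
  by (intro ext) (simp add: psi_eq chain_part_phi[OF x])

lemma phi_psi:
  assumes a: "a \<in> mu_cells K n"
  shows "phi K n (psi K n a) = a"
proof (intro poly_mapping_eqI)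
  fix i b
  have ch: "is_chain B a" and deg: "cdeg a \<le> int n"
    using a by (auto simp: mu_cells_iff)
  have "lk (Poly_Mapping.lookup (phi K n (psi K n a)) i) b = lk (Poly_Mapping.lookup a i) b"
    using ch deg
    by (simp add: lookup_lookup_phi[OF psi_closed[OF a]])
       (simp add: psi_eq lookup_chain_eq_min cdeg_le_iff)
  then show "lk (Poly_Mapping.lookup (phi K n (psi K n a)) i) b = lk (Poly_Mapping.lookup a i) b" .
qed

lemma chain_bnd_phi:
  assumes x: "x \<in> nu_cells K n" and k: "k < n"
  shows "chain_bnd K B \<alpha> k (phi K n x) = phi K k (nu_bnd n k \<alpha> x)"
proof (intro poly_mapping_eqI)
  fix i b
  show "lk (Poly_Mapping.lookup (chain_bnd K B \<alpha> k (phi K n x)) i) b =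
      lk (Poly_Mapping.lookup (phi K k (nu_bnd n k \<alpha> x)) i) b"
    using k chain_part_phi[OF x, of k \<alpha>]
    by (simp add: lookup_chain_bnd[OF is_chain_phi[OF x]] lookup_lookup_phi[OF x]
        lookup_lookup_phi[OF nu_bnd_closed[OF k x]])
       (auto simp: nu_bnd_def)
qed

lemma phi_unit:
  assumes x: "x \<in> nu_cells K n" and nm: "n < m"
  shows "phi K m (nu_unit K n m x) = phi K n x"
  using nm
  by (intro poly_mapping_eqI)
     (simp add: lookup_lookup_phi[OF x] lookup_lookup_phi[OF nu_unit_closed[OF nm x]],
       auto simp: nu_unit_def)

text \<open>Compared coefficient by coefficient. Below \<open>k\<close> both cells and their common
  boundary have the same chain part, so the formula returns it; the remaining degrees need the
  bounds on coefficients.\<close>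

lemma phi_comp:
  assumes c: "composable (nu K) n k x y"
  shows "phi K n (nu_comp K n k x y) = mu_comp K n k (phi K n x) (phi K n y)"
proof (intro poly_mapping_eqI)
  fix i b
  have k: "k < n" and x: "x \<in> nu_cells K n" and y: "y \<in> nu_cells K n"
    and eq: "\<And>i \<beta>. i < k \<Longrightarrow> x i \<beta> = y i \<beta>" "x k Minus = y k Plus"
    using c by (auto simp: composable_nu_iff)
  let ?X = "\<lambda>i \<beta>. lk (co i (x i \<beta>)) b" and ?Y = "\<lambda>i \<beta>. lk (co i (y i \<beta>)) b"
  note X = nu_cells_cell[OF x] and Y = nu_cells_cell[OF y]
  have nn: "0 \<le> ?X i \<beta>" "0 \<le> ?Y i \<beta>" if "i \<le> n" for i \<beta>
    using is_cell_nonneg[OF X that] is_cell_nonneg[OF Y that] by auto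
  have le1: "?X i \<beta> \<le> 1" "?Y i \<beta> \<le> 1" if "i \<le> n" for i \<beta>
    using cell_coeff_le_1[OF X that] cell_coeff_le_1[OF Y that] by auto
  have rhs: "lk (Poly_Mapping.lookup (mu_comp K n k (phi K n x) (phi K n y)) j) b =
      max (lk (Poly_Mapping.lookup (phi K n x) j) b
        - lk (Poly_Mapping.lookup (chain_bnd K B Minus k (phi K n x)) j) b
        + lk (Poly_Mapping.lookup (phi K n y) j) b) 0" for j
    by (simp add: mu_comp_def the_basis_eq Let_def lookup_pos_fsum lookup_add lookup_minus)
  note lookups = rhs lookup_chain_bnd[OF is_chain_phi[OF x]] chain_part_phi[OF x]
    lookup_lookup_phi[OF x] lookup_lookup_phi[OF y] lookup_lookup_phi[OF nu_comp_closed[OF c]]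
  consider "i < k" | "i = k" | "k < i" "i \<le> n" | "n < i"
    by linarith
  then show "lk (Poly_Mapping.lookup (phi K n (nu_comp K n k x y)) i) b =
      lk (Poly_Mapping.lookup (mu_comp K n k (phi K n x) (phi K n y)) i) b"
  proof cases
    case 1
    then show ?thesis
      using k nn(2)[of i] by (simp add: lookups) (simp add: nu_comp_eq[OF c] eq)
  next
    case 2
    \<comment> \<open>The one combination of coefficients 0 and 1 for which the next equation
      fails.\<close>
    have "\<not> (0 < ?Y k Minus \<and> 0 < ?X k Plus \<and> ?X k Minus = 0)"
      using no_return[OF X Y k] eq by auto
    then have "min (?X k Plus) (?Y k Minus) =
        max (min (?X k Plus) (?X k Minus) - ?X k Minus + min (?X k Minus) (?Y k Minus)) 0"
      using nn[of k] le1[of k] k eq by (smt (verit) less_imp_le)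
    then show ?thesis
      using k 2 by (simp add: lookups) (simp add: nu_comp_eq[OF c] eq)
  next
    case 3
    have disj: "?X i \<alpha> = 0 \<or> ?Y i \<beta> = 0" for \<alpha> \<beta>
      by (rule cells_disjoint_above[OF X Y 3]) (use eq in auto)
    \<comment> \<open>Disjointness for all four pairs of signs means that one of the two cells
      misses \<open>b\<close> in source and target alike; only then is the minimum additive.\<close>
    have "min (?X i Plus + ?Y i Plus) (?X i Minus + ?Y i Minus) =
        min (?X i Plus) (?X i Minus) + min (?Y i Plus) (?Y i Minus)"
      using disj[of Plus Plus] disj[of Plus Minus] disj[of Minus Plus] disj[of Minus Minus]
        nn[OF 3(2)] by (smt (verit))
    moreover have "0 \<le> min (?X i Plus) (?X i Minus) + min (?Y i Plus) (?Y i Minus)"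
      using nn[OF 3(2)] by simp
    ultimately show ?thesis
      using k 3 nu_cells_carrier[OF x] nu_cells_carrier[OF y]
      by (simp add: lookups) (simp add: nu_comp_eq[OF c] co_mult lookup_add)
  next
    case 4
    then show ?thesis
      using k by (simp add: lookups)
  qed
qed

lemma mu_sel [simp]: "cells (mu K) = mu_cells K" "bnd (mu K) = (\<lambda>n k \<alpha>. chain_bnd K B \<alpha> k)"
  "ocomp (mu K) = mu_comp K" "ounit (mu K) = (\<lambda>n m a. a)"
  by (simp_all add: mu_def mu_glob_def the_basis_eq)

text \<open>The explicit computations concern \<open>phi\<close>, while transport needs an injection
  out of \<open>mu K\<close>. Here and in the next lemmas the results are carried over to the
  inverse map.\<close>

lemma psi_bnd:
  assumes "k < n" "a \<in> mu_cells K n"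
  shows "chain_bnd K B \<alpha> k a \<in> mu_cells K k" "psi K k (chain_bnd K B \<alpha> k a) = nu_bnd n k \<alpha> (psi K n a)"
  using chain_bnd_phi[OF psi_closed[OF assms(2)] assms(1), of \<alpha>]
    nu_bnd_closed[OF assms(1) psi_closed[OF assms(2)], of \<alpha>] phi_psi[OF assms(2)]
  by (simp_all add: phi_closed psi_phi)

lemma psi_composable:
  assumes "composable (mu K) n k a a'"
  shows "composable (nu K) n k (psi K n a) (psi K n a')"
  using assms psi_closed psi_bnd unfolding composable_def by (metis mu_sel(1,2) nu_sel(1,2))

lemma psi_comp:
  assumes "composable (mu K) n k a a'"
  shows "mu_comp K n k a a' \<in> mu_cells K n"
    "psi K n (mu_comp K n k a a') = nu_comp K n k (psi K n a) (psi K n a')"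
proof -
  have "a \<in> mu_cells K n" "a' \<in> mu_cells K n"
    using assms by (auto simp: composable_def)
  then have "mu_comp K n k a a' = phi K n (nu_comp K n k (psi K n a) (psi K n a'))"
    using phi_comp[OF psi_composable[OF assms]] by (simp add: phi_psi)
  then show "mu_comp K n k a a' \<in> mu_cells K n"
    "psi K n (mu_comp K n k a a') = nu_comp K n k (psi K n a) (psi K n a')"
    using nu_comp_closed[OF psi_composable[OF assms]] by (simp_all add: phi_closed psi_phi)
qed

lemma psi_unit:
  assumes "n < m" "a \<in> mu_cells K n"
  shows "a \<in> mu_cells K m" "psi K m a = nu_unit K n m (psi K n a)"
  using phi_unit[OF psi_closed[OF assms(2)] assms(1)] phi_psi[OF assms(2)]
    nu_unit_closed[OF assms(1) psi_closed[OF assms(2)]]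
  by (metis phi_closed, metis psi_phi)

lemma omega_category_mu: "omega_category (mu K)"
proof (rule omega_category_transport[where G = "psi K", OF omega_category_nu])
  show "inj_on (psi K n) (cells (mu K) n)" for n
    by (rule inj_on_inverseI[where g = "phi K n"]) (simp add: phi_psi)
qed (simp_all add: psi_closed psi_bnd psi_comp, simp_all add: psi_unit)

lemma omega_functor_psi: "omega_functor (mu K) (nu K) (\<lambda>n. restrict (psi K n) (mu_cells K n))"
proof
  fix n k m a a' \<alpha>
  show "restrict (psi K n) (mu_cells K n) \<in> cells (mu K) n \<rightarrow>\<^sub>E cells (nu K) n"
    by (auto simp: psi_closed)
  show "restrict (psi K k) (mu_cells K k) (bnd (mu K) n k \<alpha> a) =
      bnd (nu K) n k \<alpha> (restrict (psi K n) (mu_cells K n) a)" if "k < n" "a \<in> cells (mu K) n"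
    using that by (simp add: psi_bnd)
  show "restrict (psi K n) (mu_cells K n) (ocomp (mu K) n k a a') =
      ocomp (nu K) n k (restrict (psi K n) (mu_cells K n) a) (restrict (psi K n) (mu_cells K n) a')"
    if "composable (mu K) n k a a'"
    using that psi_comp[OF that] by (simp add: composable_def)
  show "restrict (psi K m) (mu_cells K m) (ounit (mu K) n m a) =
      ounit (nu K) n m (restrict (psi K n) (mu_cells K n) a)" if "n < m" "a \<in> cells (mu K) n"
    using that psi_unit[of n m a] by simp
qed

lemma omega_functor_phi: "omega_functor (nu K) (mu K) (\<lambda>n. restrict (phi K n) (nu_cells K n))"
  and omega_iso_psi: "omega_iso (mu K) (nu K) (\<lambda>n. restrict (psi K n) (mu_cells K n))"
proof -
  show "omega_functor (nu K) (mu K) (\<lambda>n. restrict (phi K n) (nu_cells K n))"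
    "omega_iso (mu K) (nu K) (\<lambda>n. restrict (psi K n) (mu_cells K n))"
    by (rule omega_iso_of_inverse[OF omega_category_mu omega_functor_psi,
          where G = "\<lambda>n. restrict (phi K n) (nu_cells K n)"];
        simp add: phi_closed psi_closed phi_psi psi_phi)+
qed

end

section \<open>Functoriality\<close>

context adc_morphism
begin

lemma map_carrier: "x \<in> carrier (grp K n) \<Longrightarrow> f n x \<in> carrier (grp L n)"
  using f_hom by (rule hom_in_carrier)

lemma map_mult:
  "x \<in> carrier (grp K n) \<Longrightarrow> y \<in> carrier (grp K n) \<Longrightarrow>
    f n (x \<otimes>\<^bsub>grp K n\<^esub> y) = f n x \<otimes>\<^bsub>grp L n\<^esub> f n y"
  using f_hom by (rule hom_mult)

end

lemma adc_morphism_id: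
  assumes "augmented_directed_complex K"
  shows "adc_morphism K K (\<lambda>n. \<lambda>x\<in>carrier (grp K n). x)"
proof -
  interpret K: augmented_directed_complex K by fact
  have "Group.monoid (grp K n)" for n
    using K.grp_comm comm_group.axioms(2) group.is_monoid by blast
  moreover have "diff K n x \<in> carrier (grp K n)" if "x \<in> carrier (grp K (Suc n))" for n x
    using K.diff_hom that by (rule hom_in_carrier)
  moreover have "pos K n \<subseteq> carrier (grp K n)" for n
    using K.pos_submonoid by (rule submonoid.subset)
  ultimately show ?thesis
    by unfold_locales (auto simp: hom_def monoid.m_closed subset_iff)
qed

lemma adc_morphism_compose:
  assumes K: "augmented_directed_complex K"
    and f: "adc_morphism K L f" and g: "adc_morphism L M g"
  shows "adc_morphism K M (\<lambda>n. compose (carrier (grp K n)) (g n) (f n))"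
proof -
  interpret K: augmented_directed_complex K by fact
  interpret f: adc_morphism K L f by fact
  interpret g: adc_morphism L M g by fact
  have mon: "Group.monoid (grp K n)" for n
    using K.grp_comm comm_group.axioms(2) group.is_monoid by blast
  have diff: "diff K n x \<in> carrier (grp K n)" if "x \<in> carrier (grp K (Suc n))" for n x
    using K.diff_hom that by (rule hom_in_carrier)
  have pos: "pos K n \<subseteq> carrier (grp K n)" for n
    using K.pos_submonoid by (rule submonoid.subset)
  show ?thesis
  proof
    show "compose (carrier (grp K n)) (g n) (f n) \<in> hom (grp K n) (grp M n)" for n
      using mon[of n]
      by (auto simp: hom_def compose_eq monoid.m_closed f.map_carrier f.map_mult g.map_carrier g.map_mult)
    show "compose (carrier (grp K n)) (g n) (f n) \<in> extensional (carrier (grp K n))" for n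
      by (rule compose_extensional)
    show "compose (carrier (grp K n)) (g n) (f n) (diff K n x) =
        diff M n (compose (carrier (grp K (Suc n))) (g (Suc n)) (f (Suc n)) x)"
      if "x \<in> carrier (grp K (Suc n))" for n x
      using that by (simp add: compose_eq diff f.f_diff g.f_diff f.map_carrier)
    show "aug M (compose (carrier (grp K 0)) (g 0) (f 0) x) = aug K x"
      if "x \<in> carrier (grp K 0)" for x
      using that by (simp add: compose_eq f.f_aug g.f_aug f.map_carrier)
    show "compose (carrier (grp K n)) (g n) (f n) ` pos K n \<subseteq> pos M n" for n
      using pos[of n] f.f_pos[of n] g.f_pos[of n] by (auto simp: compose_eq subset_iff)
  qed
qed

lemma is_category_CDA_B: "is_category CDA_B"
proof -
  have id_left: "(\<lambda>n. compose (carrier (grp K n)) (\<lambda>x\<in>carrier (grp L n). x) (f n)) = f"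
    and id_right: "(\<lambda>n. compose (carrier (grp K n)) (f n) (\<lambda>x\<in>carrier (grp K n). x)) = f"
    if "adc_morphism K L f" for K :: "'a adc" and L :: "'a adc" and f
  proof -
    interpret adc_morphism K L f by fact
    have "compose (carrier (grp K n)) (\<lambda>x\<in>carrier (grp L n). x) (f n) = f n"
      "compose (carrier (grp K n)) (f n) (\<lambda>x\<in>carrier (grp K n). x) = f n" for n
      by (rule extensionalityI[OF compose_extensional f_extensional];
          simp add: compose_eq map_carrier)+
    then show "(\<lambda>n. compose (carrier (grp K n)) (\<lambda>x\<in>carrier (grp L n). x) (f n)) = f"
      "(\<lambda>n. compose (carrier (grp K n)) (f n) (\<lambda>x\<in>carrier (grp K n). x)) = f"
      by auto
  qed
  have assoc: "compose (carrier (grp K n)) (compose (carrier (grp L n)) h g) (f n) =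
      compose (carrier (grp K n)) h (compose (carrier (grp K n)) g (f n))"
    if "adc_morphism K L f" for K :: "'a adc" and L :: "'a adc" and f g n and h :: "'a \<Rightarrow> 'a"
  proof -
    interpret adc_morphism K L f by fact
    show ?thesis
      by (rule extensionalityI[OF compose_extensional compose_extensional])
         (simp add: compose_eq map_carrier)
  qed
  show ?thesis
    by unfold_locales
       (auto simp: CDA_B_def adc_morphism_id adc_morphism_compose id_left id_right assoc)
qed

lemma CDA_B_Ob_ulf: "K \<in> Ob CDA_B \<Longrightarrow> ulf_complex K (the_basis K)"
  using the_basis_ulf[of K]
  by (auto simp: CDA_B_def ulf_complex_def adc_with_basis_def adc_with_basis_axioms_def
      ulf_complex_axioms_def unitary_loop_free_basis_def)

lemma CDA_B_Hom: "f \<in> Hom CDA_B K L \<longleftrightarrow> adc_morphism K L f"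
  by (simp add: CDA_B_def)

section \<open>The functor \<open>nu\<close>\<close>

lemma nu_map_apply:
  "x \<in> nu_cells K n \<Longrightarrow> nu_map K L f n x = (\<lambda>k \<alpha>. if k \<le> n then f k (x k \<alpha>) else undefined)"
  by (simp add: nu_map_def)

text \<open>The clauses of \<open>nu_cells\<close> are preserved one by one, by positivity,
  compatibility with the boundary, and compatibility with the augmentation. The operations are
  entrywise group operations, which homomorphisms respect.\<close>

lemma omega_functor_nu_map:
  assumes "ulf_complex K B" "ulf_complex L C" "adc_morphism K L f"
  shows "omega_functor (nu K) (nu L) (nu_map K L f)"
proof -
  interpret K: ulf_complex K B by fact
  interpret L: ulf_complex L C by fact
  interpret f: adc_morphism K L f by fact
  have f_one: "f n \<one>\<^bsub>grp K n\<^esub> = \<one>\<^bsub>grp L n\<^esub>" for n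
    using f.f_hom K.is_group L.is_group by (rule hom_one)
  have f_inv: "f n (inv\<^bsub>grp K n\<^esub> x) = inv\<^bsub>grp L n\<^esub> (f n x)" if "x \<in> carrier (grp K n)" for n x
  proof -
    interpret group_hom "grp K n" "grp L n" "f n"
      using f.f_hom K.is_group L.is_group by (intro group_hom.intro group_hom_axioms.intro)
    show ?thesis
      using that by simp
  qed
  have closed: "nu_map K L f n x \<in> nu_cells L n" if x: "x \<in> nu_cells K n" for n x
  proof -
    have "diff L k (f (Suc k) (x (Suc k) \<alpha>)) =
        f k (x k Plus) \<otimes>\<^bsub>grp L k\<^esub> inv\<^bsub>grp L k\<^esub> (f k (x k Minus))" if "k < n" for k \<alpha>
    proof -
      have "diff K k (x (Suc k) \<alpha>) = x k Plus \<otimes>\<^bsub>grp K k\<^esub> inv\<^bsub>grp K k\<^esub> (x k Minus)"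
        using x that by (simp add: nu_cells_def)
      then show ?thesis
        using K.nu_cells_carrier[OF x] that f.f_diff[of "x (Suc k) \<alpha>" k]
        by (simp add: f.map_mult f_inv)
    qed
    moreover have "aug L (f 0 (x 0 \<alpha>)) = 1" for \<alpha>
      using x K.nu_cells_carrier[OF x, of 0] by (simp add: f.f_aug nu_cells_def)
    moreover have "f k (x k \<alpha>) \<in> pos L k" if "k \<le> n" for k \<alpha>
      using x that f.f_pos[of k] by (auto simp: nu_cells_def)
    ultimately show ?thesis
      using x by (simp add: nu_map_apply nu_cells_def)
  qed
  have bnd: "nu_map K L f k (nu_bnd n k \<alpha> x) = nu_bnd n k \<alpha> (nu_map K L f n x)"
    if "k < n" "x \<in> nu_cells K n" for k n \<alpha> x
    using that K.nu_bnd_closed[OF that]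
    by (intro ext) (simp add: nu_map_apply, simp add: nu_bnd_def)
  show ?thesis
  proof
    show "nu_map K L f n \<in> cells (nu K) n \<rightarrow>\<^sub>E cells (nu L) n" for n
      using closed by (auto simp: nu_map_def)
    show "nu_map K L f k (bnd (nu K) n k \<alpha> x) = bnd (nu L) n k \<alpha> (nu_map K L f n x)"
      if "k < n" "x \<in> cells (nu K) n" for k n \<alpha> x
      using bnd that by simp
  next
    fix n k x y assume c: "composable (nu K) n k x y"
    then have xy: "x \<in> nu_cells K n" "y \<in> nu_cells K n"
      by (auto simp: K.composable_nu_iff)
    have c': "composable (nu L) n k (nu_map K L f n x) (nu_map K L f n y)"
      using c bnd closed unfolding composable_def by (metis K.nu_sel(1,2) L.nu_sel(1,2))
    have "nu_map K L f n (nu_comp K n k x y) =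
        nu_comp L n k (nu_map K L f n x) (nu_map K L f n y)"
    proof (intro ext)
      fix i \<beta>
      show "nu_map K L f n (nu_comp K n k x y) i \<beta> =
          nu_comp L n k (nu_map K L f n x) (nu_map K L f n y) i \<beta>"
        using K.nu_cells_carrier[OF xy(1), of i] K.nu_cells_carrier[OF xy(2), of i] c
        by (simp add: nu_map_apply[OF K.nu_comp_closed[OF c]] L.nu_comp_eq[OF c'])
           (auto simp: nu_map_apply xy K.nu_comp_eq[OF c] f.map_mult K.composable_nu_iff)
    qed
    then show "nu_map K L f n (ocomp (nu K) n k x y) =
        ocomp (nu L) n k (nu_map K L f n x) (nu_map K L f n y)"
      by simp
  next
    fix n m x assume "n < m" "x \<in> cells (nu K) n"
    then show "nu_map K L f m (ounit (nu K) n m x) = ounit (nu L) n m (nu_map K L f n x)"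
      using K.nu_unit_closed[of n m x]
      by (intro ext) (simp add: nu_map_apply, simp add: nu_unit_def f_one)
  qed
qed

lemma is_functor_nu: "is_functor CDA_B Omega_Cat nu nu_map"
proof (intro is_functor.intro is_category_CDA_B is_category_Omega_Cat is_functor_axioms.intro)
  show "nu K \<in> Ob Omega_Cat" if "K \<in> Ob CDA_B" for K :: "'a adc"
  proof -
    interpret K: ulf_complex K "the_basis K" using that by (rule CDA_B_Ob_ulf)
    show ?thesis by (simp add: Omega_Cat_def K.omega_category_nu)
  qed
  show "nu_map K L f \<in> Hom Omega_Cat (nu K) (nu L)"
    if "K \<in> Ob CDA_B" "L \<in> Ob CDA_B" "f \<in> Hom CDA_B K L" for K L :: "'a adc" and f
    using omega_functor_nu_map[OF CDA_B_Ob_ulf CDA_B_Ob_ulf, of K L f] that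
    by (simp add: Omega_Cat_def CDA_B_Hom)
next
  fix K :: "'a adc" assume "K \<in> Ob CDA_B"
  then interpret K: ulf_complex K "the_basis K" by (rule CDA_B_Ob_ulf)
  have "nu_map K K (\<lambda>n. \<lambda>x\<in>carrier (grp K n). x) n x = cells_id (nu K) n x" for n x
    by (cases "x \<in> nu_cells K n")
       (auto simp: nu_map_def cells_id_def K.nu_cells_carrier K.nu_cells_undefined fun_eq_iff)
  then show "nu_map K K (Ident CDA_B K) = Ident Omega_Cat (nu K)"
    by (auto simp: CDA_B_def Omega_Cat_def)
next
  fix K L M :: "'a adc" and f g
  assume Ob: "K \<in> Ob CDA_B" "L \<in> Ob CDA_B" "M \<in> Ob CDA_B"
    and Hom: "f \<in> Hom CDA_B K L" "g \<in> Hom CDA_B L M"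
  interpret K: ulf_complex K "the_basis K" using Ob(1) by (rule CDA_B_Ob_ulf)
  interpret L: ulf_complex L "the_basis L" using Ob(2) by (rule CDA_B_Ob_ulf)
  interpret F: omega_functor "nu K" "nu L" "nu_map K L f"
    using K.ulf_complex_axioms L.ulf_complex_axioms Hom(1)[unfolded CDA_B_Hom]
    by (rule omega_functor_nu_map)
  have "nu_map K M (\<lambda>n. compose (carrier (grp K n)) (g n) (f n)) n x =
      cells_compose (nu K) (nu_map L M g) (nu_map K L f) n x" for n x
  proof (cases "x \<in> nu_cells K n")
    case True
    then have "nu_map K L f n x \<in> nu_cells L n"
      using globular_map_mem[OF F.globular_map_axioms, of x n] by simp
    then show ?thesis
      using True K.nu_cells_carrier[OF True]
      by (auto simp: cells_compose_apply nu_map_apply compose_eq fun_eq_iff)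
  qed (simp add: nu_map_def cells_compose_def compose_def)
  then show "nu_map K M (Comp CDA_B K L M g f) =
      Comp Omega_Cat (nu K) (nu L) (nu M) (nu_map L M g) (nu_map K L f)"
    by (auto simp: CDA_B_def Omega_Cat_def)
qed

section \<open>The functor \<open>mu\<close>\<close>

lemma mu_map_apply: "a \<in> mu_cells K n \<Longrightarrow> mu_map K L f n a = phi L n (nu_map K L f n (psi K n a))"
  by (simp add: mu_map_def)

text \<open>A morphism need not send basis elements to basis elements, so it does not act on chains
  in an evident way. It is instead exhibited as a composite of three functors, passing through
  \<open>nu\<close>.\<close>

lemma omega_functor_mu_map:
  assumes "ulf_complex K B" "ulf_complex L C" "adc_morphism K L f"
  shows "omega_functor (mu K) (mu L) (mu_map K L f)"
proof -
  interpret K: ulf_complex K B by fact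
  interpret L: ulf_complex L C by fact
  interpret F: omega_functor "nu K" "nu L" "nu_map K L f"
    using assms by (rule omega_functor_nu_map)
  let ?psi = "\<lambda>n. restrict (psi K n) (mu_cells K n)"
  let ?phi = "\<lambda>n. restrict (phi L n) (nu_cells L n)"
  have "mu_map K L f n a = cells_compose (mu K) ?phi (cells_compose (mu K) (nu_map K L f) ?psi) n a" for n a
    using globular_map_mem[OF F.globular_map_axioms, of "psi K n a" n]
    by (cases "a \<in> mu_cells K n") (auto simp: mu_map_def cells_compose_def compose_def K.psi_closed)
  then have "mu_map K L f = cells_compose (mu K) ?phi (cells_compose (mu K) (nu_map K L f) ?psi)"
    by auto
  then show ?thesis
    using K.omega_category_mu K.omega_functor_psi L.omega_functor_phi F.omega_functor_axioms
    by (auto intro!: omega_functor_compose)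
qed

text \<open>Conjugation by inverse maps: between two consecutive morphisms \<open>psi\<close> and
  \<open>phi\<close> cancel, and functoriality of \<open>nu\<close> gives the rest.\<close>

lemma is_functor_mu: "is_functor CDA_B Omega_Cat mu mu_map"
proof (intro is_functor.intro is_category_CDA_B is_category_Omega_Cat is_functor_axioms.intro)
  show "mu K \<in> Ob Omega_Cat" if "K \<in> Ob CDA_B" for K :: "'a adc"
  proof -
    interpret K: ulf_complex K "the_basis K" using that by (rule CDA_B_Ob_ulf)
    show ?thesis by (simp add: Omega_Cat_def K.omega_category_mu)
  qed
  show "mu_map K L f \<in> Hom Omega_Cat (mu K) (mu L)"
    if "K \<in> Ob CDA_B" "L \<in> Ob CDA_B" "f \<in> Hom CDA_B K L" for K L :: "'a adc" and f
    using omega_functor_mu_map[OF CDA_B_Ob_ulf CDA_B_Ob_ulf, of K L f] that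
    by (simp add: Omega_Cat_def CDA_B_Hom)
next
  fix K :: "'a adc" assume K: "K \<in> Ob CDA_B"
  then interpret K: ulf_complex K "the_basis K" by (rule CDA_B_Ob_ulf)
  have "nu_map K K (Ident CDA_B K) = cells_id (nu K)"
    using is_functor.preserves_ident[OF is_functor_nu K] by (simp add: Omega_Cat_def)
  then have "mu_map K K (Ident CDA_B K) n a = cells_id (mu K) n a" for n a
    by (auto simp: mu_map_def cells_id_def K.psi_closed K.phi_psi)
  then show "mu_map K K (Ident CDA_B K) = Ident Omega_Cat (mu K)"
    by (auto simp: Omega_Cat_def)
next
  fix K L M :: "'a adc" and f g
  assume Ob: "K \<in> Ob CDA_B" "L \<in> Ob CDA_B" "M \<in> Ob CDA_B"
    and Hom: "f \<in> Hom CDA_B K L" "g \<in> Hom CDA_B L M"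
  interpret K: ulf_complex K "the_basis K" using Ob(1) by (rule CDA_B_Ob_ulf)
  interpret L: ulf_complex L "the_basis L" using Ob(2) by (rule CDA_B_Ob_ulf)
  interpret F: omega_functor "nu K" "nu L" "nu_map K L f"
    using K.ulf_complex_axioms L.ulf_complex_axioms Hom(1)[unfolded CDA_B_Hom]
    by (rule omega_functor_nu_map)
  have comp: "nu_map K M (Comp CDA_B K L M g f) = cells_compose (nu K) (nu_map L M g) (nu_map K L f)"
    using is_functor.preserves_comp[OF is_functor_nu Ob Hom] by (simp add: Omega_Cat_def)
  have "mu_map K M (Comp CDA_B K L M g f) n a =
      cells_compose (mu K) (mu_map L M g) (mu_map K L f) n a" for n a
  proof (cases "a \<in> mu_cells K n")
    case True
    then have "nu_map K L f n (psi K n a) \<in> nu_cells L n"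
      using globular_map_mem[OF F.globular_map_axioms, of "psi K n a" n] by (simp add: K.psi_closed)
    then show ?thesis
      using True
      by (simp add: cells_compose_apply mu_map_apply comp K.psi_closed L.psi_phi L.phi_closed)
  qed (simp add: mu_map_def cells_compose_def compose_def)
  then show "mu_map K M (Comp CDA_B K L M g f) =
      Comp Omega_Cat (mu K) (mu L) (mu M) (mu_map L M g) (mu_map K L f)"
    by (auto simp: Omega_Cat_def)
qed

section \<open>Underlying globular sets and naturality\<close>

lemma truncate_mu: "globset.truncate (mu K) = mu_glob K"
  by (simp add: globset.truncate_def mu_def mu_glob_def)

lemma globular_set_truncate: "globular_set X \<Longrightarrow> globular_set (globset.truncate X)"
  by (simp add: globular_set_def globset.truncate_def)

lemma globular_map_truncate:
  "globular_map X Y F \<Longrightarrow> globular_map (globset.truncate X) (globset.truncate Y) F"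
  by (simp add: globular_map_def globset.truncate_def)

text \<open>Identities and composites of maps depend only on the sets of cells, which truncation
  leaves alone; so the same action on morphisms works in \<open>Glob\<close>.\<close>

lemma is_functor_truncate:
  assumes "is_functor C Omega_Cat Fo Fm"
  shows "is_functor C Glob (\<lambda>X. globset.truncate (Fo X)) Fm"
proof -
  interpret is_functor C Omega_Cat Fo Fm by fact
  show ?thesis
  proof (intro is_functor.intro dom.is_category_axioms is_category_Glob is_functor_axioms.intro)
    show "globset.truncate (Fo X) \<in> Ob Glob" if "X \<in> Ob C" for X
      using ob_closed[OF that]
      by (simp add: Glob_def Omega_Cat_def globular_set_truncate omega_category.axioms(1))
    show "Fm X Y f \<in> Hom Glob (globset.truncate (Fo X)) (globset.truncate (Fo Y))"
      if "X \<in> Ob C" "Y \<in> Ob C" "f \<in> Hom C X Y" for X Y f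
      using hom_closed[OF that]
      by (simp add: Glob_def Omega_Cat_def globular_map_truncate omega_functor.axioms(1))
    show "Fm X X (Ident C X) = Ident Glob (globset.truncate (Fo X))" if "X \<in> Ob C" for X
      using preserves_ident[OF that]
      by (simp add: Glob_def Omega_Cat_def cells_id_def globset.truncate_def fun_eq_iff)
    show "Fm X Z (Comp C X Y Z g f) = Comp Glob (globset.truncate (Fo X)) (globset.truncate (Fo Y))
        (globset.truncate (Fo Z)) (Fm Y Z g) (Fm X Y f)"
      if "X \<in> Ob C" "Y \<in> Ob C" "Z \<in> Ob C" "f \<in> Hom C X Y" "g \<in> Hom C Y Z" for X Y Z f g
      using preserves_comp[OF that]
      by (simp add: Glob_def Omega_Cat_def cells_compose_def globset.truncate_def fun_eq_iff)
  qed
qed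

text \<open>By definition \<open>mu_map\<close> ends with \<open>phi\<close>, which the following
  \<open>psi\<close> cancels.\<close>

lemma psi_natural:
  assumes "ulf_complex K B" "ulf_complex L C" "adc_morphism K L f"
  shows "cells_compose (mu K) (\<lambda>n. restrict (psi L n) (mu_cells L n)) (mu_map K L f) =
    cells_compose (mu K) (nu_map K L f) (\<lambda>n. restrict (psi K n) (mu_cells K n))"
proof (rule ext, rule ext)
  fix n a
  interpret K: ulf_complex K B by fact
  interpret L: ulf_complex L C by fact
  interpret F: omega_functor "nu K" "nu L" "nu_map K L f"
    using assms by (rule omega_functor_nu_map)
  show "cells_compose (mu K) (\<lambda>n. restrict (psi L n) (mu_cells L n)) (mu_map K L f) n a =
    cells_compose (mu K) (nu_map K L f) (\<lambda>n. restrict (psi K n) (mu_cells K n)) n a"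
    using globular_map_mem[OF F.globular_map_axioms, of "psi K n a" n]
    by (cases "a \<in> mu_cells K n")
       (auto simp: cells_compose_def compose_def mu_map_apply K.psi_closed L.phi_closed L.psi_phi)
qed

theorem mainTheorem5:
  shows
    "(\<forall>K :: 'a adc. augmented_directed_complex K \<longrightarrow> (\<exists>B. unitary_loop_free_basis K B) \<longrightarrow>
        omega_category (mu K) \<and> globset.truncate (mu K) = mu_glob K \<and>
        (\<exists>F. omega_iso (mu K) (nu K) F)) \<and>
     is_functor (CDA_B :: ('a adc, nat \<Rightarrow> 'a \<Rightarrow> 'a) category) Glob mu_glob mu_map \<and>
     is_functor (CDA_B :: ('a adc, nat \<Rightarrow> 'a \<Rightarrow> 'a) category) Omega_Cat mu mu_map \<and>
     omega_functors_isomorphic (CDA_B :: ('a adc, nat \<Rightarrow> 'a \<Rightarrow> 'a) category) mu mu_map nu nu_map"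
proof (intro conjI allI impI)
  fix K :: "'a adc"
  assume "augmented_directed_complex K" "\<exists>B. unitary_loop_free_basis K B"
  then have "K \<in> Ob CDA_B"
    by (simp add: CDA_B_def)
  then interpret K: ulf_complex K "the_basis K" by (rule CDA_B_Ob_ulf)
  show "omega_category (mu K)" "globset.truncate (mu K) = mu_glob K"
    "\<exists>F. omega_iso (mu K) (nu K) F"
    using K.omega_category_mu truncate_mu K.omega_iso_psi by auto
next
  \<comment> \<open>Forgetting the operations of \<open>mu K\<close> yields \<open>mu_glob K\<close>
    on the nose, so the lift is strict and the functor to \<open>Glob\<close> is a
    truncation.\<close>
  show "is_functor (CDA_B :: ('a adc, nat \<Rightarrow> 'a \<Rightarrow> 'a) category) Glob mu_glob mu_map"
    using is_functor_truncate[OF is_functor_mu] by (simp add: truncate_mu)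
  show "is_functor (CDA_B :: ('a adc, nat \<Rightarrow> 'a \<Rightarrow> 'a) category) Omega_Cat mu mu_map"
    by (rule is_functor_mu)
  show "omega_functors_isomorphic (CDA_B :: ('a adc, nat \<Rightarrow> 'a \<Rightarrow> 'a) category) mu mu_map nu nu_map"
    unfolding omega_functors_isomorphic_def
  proof (intro conjI is_functor_mu is_functor_nu)
    \<comment> \<open>The components point from \<open>mu\<close> to \<open>nu\<close>, hence
      \<open>psi\<close>; the restriction makes them extensional, as functors of omega-categories
      are.\<close>
    let ?eta = "\<lambda>(K :: 'a adc) n. restrict (psi K n) (mu_cells K n)"
    have "omega_iso (mu K) (nu K) (?eta K)" if "K \<in> Ob CDA_B" for K
      using that by (rule ulf_complex.omega_iso_psi[OF CDA_B_Ob_ulf])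
    moreover have "cells_compose (mu K) (?eta L) (mu_map K L f) = cells_compose (mu K) (nu_map K L f) (?eta K)"
      if "K \<in> Ob CDA_B" "L \<in> Ob CDA_B" "f \<in> Hom CDA_B K L" for K L f
      using psi_natural[OF CDA_B_Ob_ulf CDA_B_Ob_ulf] that by (simp add: CDA_B_Hom)
    ultimately show "\<exists>\<eta>. (\<forall>K\<in>Ob CDA_B. omega_iso (mu K) (nu K) (\<eta> K)) \<and>
        (\<forall>K\<in>Ob CDA_B. \<forall>L\<in>Ob CDA_B. \<forall>f\<in>Hom CDA_B K L. cells_compose (mu K) (\<eta> L) (mu_map K L f) =
          cells_compose (mu K) (nu_map K L f) (\<eta> (K :: 'a adc)))"
      by (intro exI[of _ ?eta]) blast
  qed
qed

end
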